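(* Let $f:B(0,r)\to\mathbb{R}$ satisfy Assumption A (stated in the context) with exponent $\alpha>2$. Let $(\mu_\lambda)_{\lambda\in\mathbb{N}}$ be a sequence of integers such that $1\le\mu_\lambda\le\lambda-1$ for all $\lambda\ge 2$ and $\mu_\lambda\to\infty$ as $\lambda\to\infty$. Then there exist two constants $C,C'>0$ and $\tilde\lambda\in\mathbb{N}$ such that for all integers $\lambda\ge\tilde\lambda$, $$\mathbb{E}_{X_1,\dots,X_\lambda\sim U(B(0,r))}\left[f(\bar X_{(\mu_\lambda)})\right]\le C\,\frac{\mu_\lambda^{\frac{2(\alpha-1)}{d}}}{\lambda^{\frac{2(\alpha-1)}{d}}}+C'\,\frac{\mu_\lambda^{\frac{2}{d}-1}}{\lambda^{\frac2d}}.$$ In particular, if $\mu_\lambda\sim C''\lambda^{\frac{2(\alpha-2)}{d+2(\alpha-2)}}$ as $\lambda\to\infty$ for some $C''>0$, then there is a constant $C'''>0$ independent of $\lambda$ such that for all integers $\lambda\ge\tilde\lambda$, $$\mathbb{E}_{X_1,\dots,X_\lambda\sim U(B(0,r))}\left[f(\bar X_{(\mu_\lambda)})\right]\le C'''\lambda^{-\frac{2(\alpha-1)}{d+2(\alpha-2)}}.$$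
   Context: Here $d\ge1$ is an integer, $r>0$, $\|\cdot\|$ is the Euclidean norm on $\mathbb{R}^d$, $B(0,r)$ is the closed Euclidean ball of radius $r$ centered at $0$, and $U(S)$ is the uniform distribution on $S$. Assumption A: $f:B(0,r)\to\mathbb{R}$ is continuous and admits a unique optimum point (global minimizer) $x^\star$, with $\|x^\star\|<r$ and $f(x^\star)=0$. Moreover there are a symmetric positive definite matrix $\mathbf{H}$, a real number $\alpha>2$ and a bounded function $\varepsilon$ (there is $M>0$ with $|\varepsilon|\le M$ everywhere) such that for all $x\in B(0,r)$, $$f(x)=\|x-x^\star\|_{\mathbf{H}}^2+\|x-x^\star\|_{\mathbf{H}}^{\alpha}\,\varepsilon(x-x^\star),\qquad \|y\|_{\mathbf{H}}:=\sqrt{y^T\mathbf{H}y}.$$ Sampling: $X_1,\dots,X_\lambda$ are i.i.d. with law $U(B(0,r))$; $X_{(1)},\dots,X_{(\lambda)}$ denote the same points reordered so that $f(X_{(1)})\le\dots\le f(X_{(\lambda)})$ (ties broken by smallest index), and $\bar X_{(\mu)}=\frac1\mu\sum_{i=1}^{\mu}X_{(i)}$. *)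

theory Defs
  imports "HOL-Probability.Probability" "HOL-Library.Landau_Symbols"
begin

unbundle asymp_equiv_syntax

definition pos_def_matrix :: "real ^ 'n ^ 'n \<Rightarrow> bool" where
  "pos_def_matrix H \<longleftrightarrow> transpose H = H \<and> (\<forall>y. y \<noteq> 0 \<longrightarrow> 0 < y \<bullet> (H *v y))"

definition mat_norm :: "real ^ 'n ^ 'n \<Rightarrow> real ^ 'n \<Rightarrow> real" where
  "mat_norm H y = sqrt (y \<bullet> (H *v y))"

text \<open>The objective is a function on the closed ball only; its values outside \<open>cball 0 r\<close>
  are unconstrained.\<close>

definition assumption_A :: "real \<Rightarrow> real \<Rightarrow> (real ^ 'n \<Rightarrow> real) \<Rightarrow> bool" where
  "assumption_A r \<alpha> f \<longleftrightarrow>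
     continuous_on (cball 0 r) f \<and> \<alpha> > 2 \<and>
     (\<exists>xs. (\<forall>x. is_arg_min f (\<lambda>y. y \<in> cball 0 r) x \<longleftrightarrow> x = xs) \<and> norm xs < r \<and> f xs = 0 \<and>
       (\<exists>H \<epsilon> M. pos_def_matrix H \<and> M > 0 \<and> (\<forall>y. \<bar>\<epsilon> y\<bar> \<le> M) \<and>
         (\<forall>x\<in>cball 0 r.
            f x = mat_norm H (x - xs) ^ 2 + mat_norm H (x - xs) powr \<alpha> * \<epsilon> (x - xs))))"

text \<open>The underlying space is \<open>S\<close> itself rather than the whole of \<open>real ^ 'n\<close>: otherwise the
  unconstrained values of the objective outside the ball could make the integrands below
  non-measurable, and their Bochner integrals would be 0 by default.\<close>

definition unif :: "(real ^ 'n) set \<Rightarrow> (real ^ 'n) measure" where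
  "unif S = uniform_measure (restrict_space lborel S) S"

definition sample_law :: "real \<Rightarrow> nat \<Rightarrow> (nat \<Rightarrow> real ^ 'n) measure" where
  "sample_law r l = PiM {1..l} (\<lambda>_. unif (cball 0 r))"

text \<open>\<open>sort_key\<close> is stable, so ties are broken by smallest index.\<close>

definition ordered_point :: "(real ^ 'n \<Rightarrow> real) \<Rightarrow> nat \<Rightarrow> (nat \<Rightarrow> real ^ 'n) \<Rightarrow> nat \<Rightarrow> real ^ 'n" where
  "ordered_point f l X i = X (sort_key (\<lambda>j. f (X j)) [1..<Suc l] ! (i - 1))"

definition best_mean :: "(real ^ 'n \<Rightarrow> real) \<Rightarrow> nat \<Rightarrow> nat \<Rightarrow> (nat \<Rightarrow> real ^ 'n) \<Rightarrow> real ^ 'n" where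
  "best_mean f l m X = (1 / real m) *\<^sub>R (\<Sum>i=1..m. ordered_point f l X i)"

definition expected_value :: "real \<Rightarrow> (real ^ 'n \<Rightarrow> real) \<Rightarrow> nat \<Rightarrow> nat \<Rightarrow> real" where
  "expected_value r f l m = (LINT X|sample_law r l. f (best_mean f l m X))"

text \<open>The remaining facts show that the Bochner integral in \<open>expected_value\<close> is a genuine
  expectation, i.e. that its integrand is integrable.\<close>

lemma prob_space_unif_cball:
  assumes "r > 0"
  shows "prob_space (unif (cball (0 :: real ^ 'n) r))"
proof -
  have *: "emeasure (restrict_space lborel (cball (0 :: real ^ 'n) r)) (cball 0 r)
      = emeasure lborel (cball (0 :: real ^ 'n) r)"
    by (subst emeasure_restrict_space) auto
  have "emeasure lborel (cball (0 :: real ^ 'n) r) \<noteq> 0"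
  proof
    assume "emeasure lborel (cball (0 :: real ^ 'n) r) = 0"
    then have "cball (0 :: real ^ 'n) r \<in> null_sets lebesgue"
      by (simp add: null_setsI null_sets_completionI)
    then have "negligible (ball (0 :: real ^ 'n) r)"
      using negligible_subset[OF _ ball_subset_cball] by (simp add: negligible_iff_null_sets)
    then show False
      using assms open_not_negligible[OF open_ball] by (metis ball_eq_empty not_le)
  qed
  moreover have "emeasure lborel (cball (0 :: real ^ 'n) r) \<noteq> \<infinity>"
    using emeasure_lborel_cball_finite[of "0 :: real ^ 'n" r] by simp
  ultimately show ?thesis
    unfolding unif_def by (intro prob_space_uniform_measure) (simp_all add: *)
qed

lemma space_sample_law: "space (sample_law r l) = PiE {1..l} (\<lambda>_. cball 0 r)"
  by (simp add: sample_law_def unif_def space_PiM space_restrict_space)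

lemma prob_space_sample_law:
  assumes "r > 0"
  shows "prob_space (sample_law r l :: (nat \<Rightarrow> real ^ 'n) measure)"
  unfolding sample_law_def using prob_space_unif_cball[OF assms] by (intro prob_space_PiM)

lemma sets_unif: "sets (unif S) = sets (restrict_space borel S)"
  by (simp add: unif_def sets_restrict_space)

lemma measurable_insort_key:
  fixes g :: "'a \<Rightarrow> 'b :: countable \<Rightarrow> real"
  assumes "\<And>j. j \<in> insert x (set l) \<Longrightarrow> (\<lambda>w. g w j) \<in> borel_measurable M"
  shows "(\<lambda>w. insort_key (g w) x l) \<in> measurable M (count_space UNIV)"
  using assms
proof (induction l)
  case (Cons y l)
  have [measurable]: "(\<lambda>w. g w x) \<in> borel_measurable M" "(\<lambda>w. g w y) \<in> borel_measurable M"
    "(\<lambda>w. insort_key (g w) x l) \<in> measurable M (count_space UNIV)"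
    using Cons by auto
  show ?case by simp
qed simp

lemma measurable_sort_key:
  fixes g :: "'a \<Rightarrow> 'b :: countable \<Rightarrow> real"
  assumes "\<And>j. j \<in> set l \<Longrightarrow> (\<lambda>w. g w j) \<in> borel_measurable M"
  shows "(\<lambda>w. sort_key (g w) l) \<in> measurable M (count_space {k. set k = set l})"
  using assms
proof (induction l)
  case Nil
  then show ?case by (simp add: sort_key_def)
next
  case (Cons x l)
  have IH: "(\<lambda>w. sort_key (g w) l) \<in> measurable M (count_space {k. set k = set l})"
    using Cons by auto
  have "(\<lambda>w. insort_key (g w) x (sort_key (g w) l)) \<in> measurable M (count_space UNIV)"
    by (rule measurable_compose_countable'[OF _ IH]) (use Cons.prems in \<open>auto intro!: measurable_insort_key\<close>)
  then have "(\<lambda>w. sort_key (g w) (x # l)) \<in> measurable M (count_space UNIV)"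
    by (simp add: sort_key_def)
  then show ?case
    by (rule measurable_count_space_extend[OF subset_UNIV, rotated])
       (auto simp: set_insort_key)
qed

lemma ordered_point_in_cball:
  assumes "X \<in> space (sample_law r l)" "1 \<le> i" "i \<le> l"
  shows "ordered_point f l X i \<in> cball 0 r"
proof -
  have "sort_key (\<lambda>j. f (X j)) [1..<Suc l] ! (i - 1) \<in> set (sort_key (\<lambda>j. f (X j)) [1..<Suc l])"
    using assms by (intro nth_mem) (simp del: upt_Suc)
  then show ?thesis
    using assms(1) unfolding ordered_point_def space_sample_law by (auto simp del: upt_Suc)
qed

lemma best_mean_in_cball:
  assumes "X \<in> space (sample_law r l)" "1 \<le> m" "m \<le> l"
  shows "best_mean f l m X \<in> cball 0 r"
proof -
  have "(\<Sum>i=1..m. (1 / real m) *\<^sub>R ordered_point f l X i) \<in> cball 0 r"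
  proof (rule convex_sum)
    show "ordered_point f l X i \<in> cball 0 r" if "i \<in> {1..m}" for i
      using that assms by (intro ordered_point_in_cball) auto
  qed (use assms in auto)
  then show ?thesis by (simp add: best_mean_def scaleR_sum_right)
qed

lemma measurable_ordered_point:
  fixes f :: "real ^ 'n \<Rightarrow> real"
  assumes f: "continuous_on (cball 0 r) f" and i: "1 \<le> i" "i \<le> l"
  shows "(\<lambda>X. ordered_point f l X i) \<in> borel_measurable (sample_law r l)"
proof -
  have comp: "(\<lambda>X :: nat \<Rightarrow> real ^ 'n. X j) \<in> measurable (sample_law r l) (restrict_space borel (cball 0 r))"
    if "j \<in> {1..l}" for j
    using measurable_component_singleton[OF that, of "\<lambda>_. unif (cball (0 :: real ^ 'n) r)"]
    unfolding sample_law_def by (simp only: measurable_cong_sets[OF refl sets_unif])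
  have meas: "(\<lambda>X :: nat \<Rightarrow> real ^ 'n. X j) \<in> borel_measurable (sample_law r l)" if "j \<in> {1..l}" for j
    using comp[OF that] by (rule iffD1[OF measurable_restrict_space2_iff, THEN conjunct1])
  have "(\<lambda>X. f (X j)) \<in> borel_measurable (sample_law r l)" if "j \<in> {1..l}" for j
    by (rule measurable_compose[OF comp[OF that] borel_measurable_continuous_on_restrict[OF f]])
  then have sort: "(\<lambda>X. sort_key (\<lambda>j. f (X j)) [1..<Suc l])
      \<in> measurable (sample_law r l) (count_space {k. set k = set [1..<Suc l]})"
    by (intro measurable_sort_key) auto
  have sk: "(\<lambda>X. sort_key (\<lambda>j. f (X j)) [1..<Suc l] ! (i - 1))
      \<in> measurable (sample_law r l) (count_space {1..l})"
  proof -
    have "(\<lambda>X. sort_key (\<lambda>j. f (X j)) [1..<Suc l] ! (i - 1))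
      \<in> measurable (sample_law r l) (count_space UNIV)"
      by (rule measurable_compose[OF sort]) simp
    moreover have "sort_key (\<lambda>j. f (X j)) [1..<Suc l] ! (i - 1) \<in> {1..l}" for X
    proof -
      have "sort_key (\<lambda>j. f (X j)) [1..<Suc l] ! (i - 1) \<in> set (sort_key (\<lambda>j. f (X j)) [1..<Suc l])"
        using i by (intro nth_mem) (simp del: upt_Suc)
      then show ?thesis by (auto simp del: upt_Suc)
    qed
    ultimately show ?thesis
      by (blast intro: measurable_count_space_extend[OF subset_UNIV Pi_I])
  qed
  show ?thesis
    unfolding ordered_point_def
    by (rule measurable_compose_countable'[where f = "\<lambda>j X. X j", OF meas sk countable_finite[OF finite_atLeastAtMost]])
qed

lemma integrable_best_mean:
  fixes f :: "real ^ 'n \<Rightarrow> real"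
  assumes "r > 0" and f: "continuous_on (cball 0 r) f" and m: "1 \<le> m" "m \<le> l"
  shows "integrable (sample_law r l) (\<lambda>X. f (best_mean f l m X))"
proof -
  interpret prob_space "sample_law r l :: (nat \<Rightarrow> real ^ 'n) measure"
    by (rule prob_space_sample_law[OF assms(1)])
  have "best_mean f l m \<in> borel_measurable (sample_law r l)"
    unfolding best_mean_def using m
    by (intro borel_measurable_scaleR borel_measurable_sum measurable_ordered_point[OF f]) auto
  then have "best_mean f l m \<in> measurable (sample_law r l) (restrict_space borel (cball 0 r))"
    using m by (intro measurable_restrict_space2 Pi_I best_mean_in_cball)
  then have meas: "(\<lambda>X. f (best_mean f l m X)) \<in> borel_measurable (sample_law r l)"
    by (rule measurable_compose[OF _ borel_measurable_continuous_on_restrict[OF f]])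
  have "bounded (f ` cball 0 r)"
    using compact_continuous_image[OF f] by (simp add: compact_imp_bounded)
  then obtain B where "\<And>x. x \<in> cball 0 r \<Longrightarrow> norm (f x) \<le> B"
    unfolding bounded_iff by blast
  then show ?thesis
    using m by (intro integrable_const_bound[where B = B] meas AE_I2) (blast intro: best_mean_in_cball)
qed

end

theory Submission
  imports Defs "HOL-Real_Asymp.Real_Asymp"
begin

text \<open>Let \<open>h = f(X\<^sub>(\<^sub>m\<^sub>+\<^sub>1\<^sub>))\<close>. Given the index and the position of the \<open>(m+1)\<close>-st best point and the set of
  indices of the \<open>m\<close> better ones, these \<open>m\<close> points are independent and uniform on the sublevel set
  \<open>{f < h}\<close> (or \<open>{f \<le> h}\<close>, for an index that wins a tie: level sets of \<open>f\<close> may have positive measure).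
  Hence the mean squared distance of their average from the minimizer is at most the squared distance
  of the barycenters of these sets from the minimizer plus \<open>O(h)/m\<close>. For small \<open>h\<close> such a set lies between
  two homothetic ellipsoids centered at the minimizer whose radii are \<open>\<surd>h\<close> up to a relative error
  \<open>O(h\<^bsup>(\<alpha>-2)/2\<^esup>)\<close>, so that its barycenter has distance \<open>O(h\<^bsup>(\<alpha>-1)/2\<^esup>)\<close> from the minimizer. This gives
  \<open>\<bbbE> f \<le> O(\<bbbE> h\<^bsup>\<alpha>-1\<^esup> + \<bbbE> h / m)\<close>. Finally \<open>P(f \<le> c) \<ge> \<kappa> c\<^bsup>d/2\<^esup>\<close> and a Chernoff bound for the number of
  points in \<open>{f \<le> c}\<close> show \<open>\<bbbE> h\<^bsup>q\<^esup> = O((m/\<lambda>)\<^bsup>2q/d\<^esup>)\<close>. All bounds hold for every \<open>1 \<le> m < \<lambda>\<close>.\<close>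

section \<open>Ranks of a stably sorted sample\<close>

text \<open>Values may tie with positive probability, so indices are compared by value and then by
  size. The order is strict and total, and every rank is attained exactly once.\<close>

definition lex_less :: "('a::linorder \<Rightarrow> real) \<Rightarrow> 'a \<Rightarrow> 'a \<Rightarrow> bool" where
  "lex_less u i j \<longleftrightarrow> u i < u j \<or> u i = u j \<and> i < j"

lemma lex_less_asym: "lex_less u i j \<Longrightarrow> \<not> lex_less u j i"
  by (auto simp: lex_less_def)

text \<open>\<open>insort_key\<close> puts \<open>x\<close> in front of the first entry whose key is
  not smaller. Since \<open>sort_key\<close> processes an increasing list from its end,
  \<open>x\<close> correctly precedes all indices with which it ties.\<close>

lemma sorted_wrt_insort_key_lex:
  assumes "sorted_wrt (lex_less u) xs" "\<forall>y\<in>set xs. x < y"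
  shows "sorted_wrt (lex_less u) (insort_key u x xs)"
  using assms
proof (induction xs)
  case (Cons y ys)
  then show ?case
    by (cases "u x \<le> u y") (auto simp: lex_less_def set_insort_key)
qed simp

lemma sorted_wrt_sort_key_lex:
  assumes "sorted_wrt (<) xs"
  shows "sorted_wrt (lex_less u) (sort_key u xs)"
  using assms
proof (induction xs)
  case Nil
  then show ?case by simp
next
  case (Cons x xs)
  then have "sorted_wrt (lex_less u) (insort_key u x (sort_key u xs))"
    by (intro sorted_wrt_insort_key_lex) auto
  then show ?case by (simp add: sort_key_def)
qed

text \<open>The cardinality is the rank of \<open>j\<close>, counted from 0. Unlike a position in
  the sorted list, it is given by separate comparisons with \<open>j\<close>, which makes
  independence usable.\<close>

definition predecessors :: "'a::linorder set \<Rightarrow> ('a \<Rightarrow> real) \<Rightarrow> 'a \<Rightarrow> 'a set" where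
  "predecessors K u j = {i \<in> K. lex_less u i j}"

context
  fixes u :: "nat \<Rightarrow> real" and l m :: nat
  assumes ml: "m < l"
begin

abbreviation (input) "srt \<equiv> sort_key u [1..<Suc l]"

lemma set_srt: "set srt = {1..l}"
  by (auto simp del: upt_Suc)

lemma length_srt: "length srt = l"
  by (simp del: upt_Suc)

lemma distinct_srt: "distinct srt"
  by (simp del: upt_Suc)

lemma srt_in: "srt ! m \<in> {1..l}"
  using nth_mem[of m srt] ml unfolding set_srt length_srt by simp

lemma lex_less_srt: "a < b \<Longrightarrow> b < l \<Longrightarrow> lex_less u (srt ! a) (srt ! b)"
  using sorted_wrt_nth_less[OF sorted_wrt_sort_key_lex[of "[1..<Suc l]" u], of a b]
    sorted_wrt_upt length_srt by (auto simp del: upt_Suc)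

text \<open>The sorted list is strictly increasing for \<open>lex_less\<close>, and asymmetry
  excludes entries at position \<open>m\<close> or later. Positions count from 0, so
  \<open>srt ! m\<close> is the (m+1)-st best index.\<close>

lemma predecessors_srt: "predecessors {1..l} u (srt ! m) = set (take m srt)"
proof (rule set_eqI)
  fix i
  show "i \<in> predecessors {1..l} u (srt ! m) \<longleftrightarrow> i \<in> set (take m srt)"
  proof
    assume "i \<in> predecessors {1..l} u (srt ! m)"
    then have i: "i \<in> set srt" "lex_less u i (srt ! m)"
      by (simp_all only: predecessors_def set_srt mem_Collect_eq)
    then obtain a where a: "a < l" "i = srt ! a"
      by (metis in_set_conv_nth length_srt)
    have "a < m"
    proof (rule ccontr)
      assume "\<not> a < m"
      then consider "a = m" | "m < a" by linarith
      then show False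
        using i(2) a lex_less_srt[of m a] lex_less_asym[of u i "srt ! m"]
        by cases (auto simp: lex_less_def)
    qed
    then show "i \<in> set (take m srt)"
      using a ml by (metis in_set_conv_nth length_srt length_take min.absorb4 nth_take)
  next
    assume "i \<in> set (take m srt)"
    then obtain a where a: "a < m" "i = srt ! a"
      by (metis in_set_conv_nth length_take min_less_iff_conj nth_take)
    then have "i \<in> set srt" "lex_less u i (srt ! m)"
      using lex_less_srt[of a m] ml length_srt by (auto simp del: upt_Suc set_sort intro!: nth_mem)
    then show "i \<in> predecessors {1..l} u (srt ! m)"
      by (simp only: predecessors_def set_srt mem_Collect_eq simp_thms)
  qed
qed

lemma card_take_srt: "card (set (take m srt)) = m"
  using distinct_card[OF distinct_take[OF distinct_srt, of m]] length_srt ml by simp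

text \<open>By totality one of two distinct indices precedes the other, and its predecessor set is
  then a proper subset; hence distinct indices have distinct ranks.\<close>

lemma card_predecessors_imp_srt:
  assumes "j \<in> {1..l}" "card (predecessors {1..l} u j) = m"
  shows "j = srt ! m"
proof (rule ccontr)
  assume ne: "j \<noteq> srt ! m"
  have fin: "finite (predecessors {1..l} u k)" for k
    by (simp add: predecessors_def)
  have card: "card (predecessors {1..l} u (srt ! m)) = m"
    using predecessors_srt card_take_srt by simp
  have mono: "predecessors {1..l} u a \<subset> predecessors {1..l} u b"
    if "lex_less u a b" "a \<in> {1..l}" for a b
    using that by (auto simp: predecessors_def lex_less_def)
  have "lex_less u j (srt ! m) \<or> lex_less u (srt ! m) j"
    using ne by (auto simp: lex_less_def)
  then have "card (predecessors {1..l} u j) \<noteq> card (predecessors {1..l} u (srt ! m))"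
    using psubset_card_mono[OF fin mono] assms(1) srt_in by fastforce
  then show False using card assms(2) by simp
qed

text \<open>Exactly one pair of \<open>j\<close> and \<open>I\<close> has a nonzero indicator. The
  identity replaces a random index and a random index set by a finite sum over deterministic ones,
  so that each expectation can be treated separately.\<close>

lemma sum_over_ranked_srt:
  fixes F :: "nat \<Rightarrow> nat set \<Rightarrow> real"
  shows "F (srt ! m) (set (take m srt)) =
    (\<Sum>j\<in>{1..l}. \<Sum>I\<in>{I. I \<subseteq> {1..l} - {j} \<and> card I = m}.
       of_bool (I = predecessors {1..l} u j) * F j I)"
proof -
  have sub: "predecessors {1..l} u j \<subseteq> {1..l} - {j}" for j
    by (auto simp: predecessors_def lex_less_def)
  have "(\<Sum>I\<in>{I. I \<subseteq> {1..l} - {j} \<and> card I = m}. of_bool (I = predecessors {1..l} u j) * F j I)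
      = of_bool (j = srt ! m) * F j (predecessors {1..l} u j)" if j: "j \<in> {1..l}" for j
  proof -
    have fin: "finite {I. I \<subseteq> {1..l} - {j} \<and> card I = m}" by simp
    have "(\<Sum>I\<in>{I. I \<subseteq> {1..l} - {j} \<and> card I = m}. of_bool (I = predecessors {1..l} u j) * F j I)
       = (\<Sum>I\<in>{I. I \<subseteq> {1..l} - {j} \<and> card I = m}. if I = predecessors {1..l} u j then F j I else 0)"
      by (intro sum.cong) auto
    also have "\<dots> = (if card (predecessors {1..l} u j) = m then F j (predecessors {1..l} u j) else 0)"
      using sub[of j] by (subst sum.delta[OF fin]) simp
    also have "card (predecessors {1..l} u j) = m \<longleftrightarrow> j = srt ! m"
      using card_predecessors_imp_srt[OF j] predecessors_srt card_take_srt by auto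
    finally show ?thesis by simp
  qed
  then have "(\<Sum>j\<in>{1..l}. \<Sum>I\<in>{I. I \<subseteq> {1..l} - {j} \<and> card I = m}.
       of_bool (I = predecessors {1..l} u j) * F j I)
     = (\<Sum>j\<in>{1..l}. if j = srt ! m then F j (predecessors {1..l} u j) else 0)"
    by (intro sum.cong) auto
  also have "\<dots> = F (srt ! m) (predecessors {1..l} u (srt ! m))"
    using srt_in by (subst sum.delta) (simp_all del: upt_Suc)
  finally show ?thesis by (simp only: predecessors_srt)
qed

lemma sum_take_srt:
  fixes G :: "nat \<Rightarrow> real"
  shows "(\<Sum>i=1..m. G (srt ! (i - 1))) = (\<Sum>i\<in>set (take m srt). G i)"
proof -
  have "(\<Sum>i\<in>set (take m srt). G i) = sum_list (map G (take m srt))"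
    using sum_list_distinct_conv_sum_set[OF distinct_take[OF distinct_srt], of G m] by simp
  also have "\<dots> = (\<Sum>i<m. G (srt ! i))"
    using length_srt ml by (simp add: sum_list_sum_nth atLeast0LessThan)
  also have "\<dots> = (\<Sum>i=1..m. G (srt ! (i - 1)))"
    by (rule sum.reindex_bij_witness[of _ "\<lambda>i. i - 1" Suc]) auto
  finally show ?thesis by simp
qed

text \<open>A point of value at most \<open>c\<close> comes strictly before position
  \<open>m\<close>. The Chernoff bound below is applied to this count.\<close>

lemma card_le_threshold_srt:
  assumes "c < u (srt ! m)"
  shows "card {i \<in> {1..l}. u i \<le> c} \<le> m"
proof -
  have "{i \<in> {1..l}. u i \<le> c} \<subseteq> set (take m srt)"
    unfolding predecessors_srt[symmetric] predecessors_def using assms by (auto simp: lex_less_def)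
  then show ?thesis
    using card_mono[of "set (take m srt)"] card_take_srt by fastforce
qed

end

section \<open>Second moment of the selected mean\<close>

lemma (in prob_space) integrable_bounded:
  fixes h :: "'a \<Rightarrow> real"
  assumes "h \<in> borel_measurable M" "\<And>x. x \<in> space M \<Longrightarrow> \<bar>h x\<bar> \<le> B"
  shows "integrable M h"
  using assms by (intro integrable_const_bound[where B = B] AE_I2) auto

context
  fixes M :: "'a measure" and f :: "'a \<Rightarrow> real" and K :: "nat set"
  assumes prob: "prob_space M" and f_meas[measurable]: "f \<in> borel_measurable M"
    and fin: "finite K"
begin

interpretation prob_space M by (rule prob)

interpretation P: product_prob_space "\<lambda>_::nat. M" K
  by unfold_locales

text \<open>Whether \<open>a\<close> precedes \<open>j\<close> depends only on \<open>X a\<close>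
  and \<open>X j\<close>, so for fixed \<open>X j\<close> the right side is a product of functions
  of single coordinates.\<close>

lemma of_bool_predecessors_eq:
  assumes "I \<subseteq> K - {j}"
  shows "of_bool (I = predecessors K (\<lambda>i. f (X i)) j) =
    (\<Prod>a\<in>K - {j}. if lex_less (\<lambda>i. f (X i)) a j \<longleftrightarrow> a \<in> I then 1 else (0::real))"
proof (cases "I = predecessors K (\<lambda>i. f (X i)) j")
  case True
  then show ?thesis by (auto simp: predecessors_def intro!: prod.neutral[symmetric])
next
  case False
  then obtain a where "a \<in> K - {j}" "\<not> (lex_less (\<lambda>i. f (X i)) a j \<longleftrightarrow> a \<in> I)"
    using assms by (auto simp: predecessors_def lex_less_def)
  then have "(\<Prod>a\<in>K - {j}. if lex_less (\<lambda>i. f (X i)) a j \<longleftrightarrow> a \<in> I then 1 else (0::real)) = 0"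
    using fin by (intro prod_zero) auto
  then show ?thesis using False by simp
qed

lemma measurable_of_bool_predecessors:
  assumes "I \<subseteq> K - {j}" and j: "j \<in> K"
  shows "(\<lambda>X. of_bool (I = predecessors K (\<lambda>i. f (X i)) j) :: real) \<in> borel_measurable (PiM K (\<lambda>_. M))"
  unfolding of_bool_predecessors_eq[OF assms(1)] lex_less_def
proof (intro borel_measurable_prod)
  fix a assume "a \<in> K - {j}"
  then have [measurable]: "a \<in> K" "j \<in> K" using j by auto
  \<comment> \<open>With the tie rule resolved, the comparison is one of two plain inequalities,
    selected by the fixed indices and not by the sample.\<close>
  have eq: "(p < q \<or> p = q \<and> a < j) \<longleftrightarrow> (if a < j then p \<le> q else p < q)" for p q :: real
    by auto
  show "(\<lambda>X. if (f (X a) < f (X j) \<or> f (X a) = f (X j) \<and> a < j) = (a \<in> I) then 1 else (0::real))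
      \<in> borel_measurable (PiM K (\<lambda>_. M))"
    unfolding eq by (cases "a \<in> I"; cases "a < j") (simp_all add: not_le)
qed

text \<open>Once \<open>X\<^sub>j\<close> is fixed, the event that \<open>I\<close> is the set of predecessors of \<open>j\<close> is a product event, so the
  expectation factorizes over the remaining coordinates.\<close>

lemma expectation_cross_term_le:
  fixes g D :: "'a \<Rightarrow> real"
  assumes g[measurable]: "g \<in> borel_measurable M" and gB: "\<And>x. x \<in> space M \<Longrightarrow> \<bar>g x\<bar> \<le> B"
    and D[measurable]: "D \<in> borel_measurable M" and D0: "\<And>x. x \<in> space M \<Longrightarrow> 0 \<le> D x"
    and DB: "\<And>x. x \<in> space M \<Longrightarrow> D x \<le> B"
    and less: "\<And>x. x \<in> space M \<Longrightarrow>
       \<bar>\<integral>y. indicator {y \<in> space M. f y < f x} y * g y \<partial>M\<bar> \<le> D x * prob {y \<in> space M. f y < f x}"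
    and le: "\<And>x. x \<in> space M \<Longrightarrow>
       \<bar>\<integral>y. indicator {y \<in> space M. f y \<le> f x} y * g y \<partial>M\<bar> \<le> D x * prob {y \<in> space M. f y \<le> f x}"
    and j: "j \<in> K" and I: "I \<subseteq> K - {j}" and ik: "i \<in> I" "k \<in> I" "i \<noteq> k"
  shows "(\<integral>X. of_bool (I = predecessors K (\<lambda>i. f (X i)) j) * (g (X i) * g (X k)) \<partial>PiM K (\<lambda>_. M))
    \<le> (\<integral>X. of_bool (I = predecessors K (\<lambda>i. f (X i)) j) * (D (X j))\<^sup>2 \<partial>PiM K (\<lambda>_. M))"
proof -
  define E where "E X = (of_bool (I = predecessors K (\<lambda>i. f (X i)) j) :: real)" for X :: "nat \<Rightarrow> 'a"
  have E[measurable]: "E \<in> borel_measurable (PiM K (\<lambda>_. M))"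
    unfolding E_def by (rule measurable_of_bool_predecessors[OF I j])
  have E01: "0 \<le> E X" "E X \<le> 1" for X by (auto simp: E_def)
  have mem[measurable]: "i \<in> K" "k \<in> K" "j \<in> K" using I ik j by auto
  let ?L = "K - {j}"
  have finL: "finite ?L" using fin by simp
  \<comment> \<open>The slice of the product event in coordinate \<open>a\<close> when
    \<open>X j = x\<close>: a strict or weak sublevel set for \<open>a\<close> in \<open>I\<close>,
    according to the tie rule, and the complement of such a set otherwise.\<close>
  define S where "S x a = {y \<in> space M. (f y < f x \<or> f y = f x \<and> a < j) \<longleftrightarrow> a \<in> I}" for x a
  have S[measurable]: "S x a \<in> sets M" for x a unfolding S_def by measurable
  define \<phi> where "\<phi> x a y = indicator (S x a) y * (if a \<in> {i, k} then g y else 1)" for x a y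
  have B0: "0 \<le> B"
    using D0 DB not_empty by (metis all_not_in_conv order_trans)
  have intF: "integrable (PiM K (\<lambda>_. M)) (\<lambda>X. E X * (g (X i) * g (X k)))"
  proof (rule P.integrable_bounded[where B = "1 * (B * B)"])
    fix X assume "X \<in> space (PiM K (\<lambda>_. M))"
    then have "X i \<in> space M" "X k \<in> space M" using mem by (auto simp: space_PiM)
    then show "\<bar>E X * (g (X i) * g (X k))\<bar> \<le> 1 * (B * B)"
      unfolding abs_mult using E01[of X] gB B0 by (intro mult_mono) auto
  qed measurable
  have intG: "integrable (PiM K (\<lambda>_. M)) (\<lambda>X. E X * (D (X j))\<^sup>2)"
  proof (rule P.integrable_bounded[where B = "1 * B\<^sup>2"])
    fix X assume "X \<in> space (PiM K (\<lambda>_. M))"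
    then have "X j \<in> space M" using mem by (auto simp: space_PiM)
    then show "\<bar>E X * (D (X j))\<^sup>2\<bar> \<le> 1 * B\<^sup>2"
      unfolding abs_mult using E01[of X] D0 DB B0 by (intro mult_mono) (auto intro!: power_mono)
  qed measurable
  \<comment> \<open>Fubini is applied once, to the difference of the two integrands. It then
    suffices that the inner integral over the coordinates other than \<open>j\<close> is nonnegative
    for every value of \<open>X j\<close>.\<close>
  define H where "H X = E X * (D (X j))\<^sup>2 - E X * (g (X i) * g (X k))" for X
  have intH: "integrable (PiM ({j} \<union> ?L) (\<lambda>_. M)) H"
    unfolding H_def using intF intG j by (simp add: insert_absorb)
  have "0 \<le> (\<integral>x. (\<integral>y. H (merge {j} ?L (x, y)) \<partial>PiM ?L (\<lambda>_. M)) \<partial>PiM {j} (\<lambda>_. M))"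
  proof (rule integral_nonneg_AE, rule AE_I2)
    fix x assume "x \<in> space (PiM {j} (\<lambda>_. M))"
    then have x: "x j \<in> space M" by (auto simp: space_PiM)
    have Em: "E (merge {j} ?L (x, y)) = (\<Prod>a\<in>?L. indicator (S (x j) a) (y a))"
      if "y \<in> space (PiM ?L (\<lambda>_. M))" for y
      unfolding E_def of_bool_predecessors_eq[OF I]
    proof (rule prod.cong[OF refl])
      fix a assume a: "a \<in> ?L"
      then have "y a \<in> space M" using that by (auto simp: space_PiM)
      then show "(if lex_less (\<lambda>i. f (merge {j} ?L (x, y) i)) a j \<longleftrightarrow> a \<in> I then 1 else 0)
          = (indicator (S (x j) a) (y a) :: real)"
        using a by (auto simp: lex_less_def S_def merge_def indicator_def)
    qed
    have prod_D: "(\<Prod>a\<in>?L. if a \<in> {i, k} then c a else 1) = c i * c k" for c :: "nat \<Rightarrow> real"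
    proof -
      have "?L \<inter> {a. a \<in> {i, k}} = {i, k}" using ik I by auto
      then show ?thesis using ik by (simp add: prod.If_cases[OF finL])
    qed
    have Hm: "H (merge {j} ?L (x, y)) =
        (D (x j))\<^sup>2 * (\<Prod>a\<in>?L. indicator (S (x j) a) (y a)) - (\<Prod>a\<in>?L. \<phi> (x j) a (y a))"
      if y: "y \<in> space (PiM ?L (\<lambda>_. M))" for y
    proof -
      have "(\<Prod>a\<in>?L. \<phi> (x j) a (y a)) = E (merge {j} ?L (x, y)) * (g (y i) * g (y k))"
        unfolding \<phi>_def prod.distrib Em[OF y] using prod_D[of "\<lambda>a. g (y a)"] by simp
      moreover have "merge {j} ?L (x, y) j = x j" "merge {j} ?L (x, y) i = y i" "merge {j} ?L (x, y) k = y k"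
        using ik I by (auto simp: merge_def)
      ultimately show ?thesis unfolding H_def Em[OF y, symmetric] by simp
    qed
    have int1: "integrable M (indicator (S (x j) a) :: _ \<Rightarrow> real)" for a
      by (intro integrable_bounded[where B = 1]) (auto simp: indicator_def)
    have int2: "integrable M (\<phi> (x j) a)" for a
    proof (rule integrable_bounded[where B = "B + 1"])
      show "\<bar>\<phi> (x j) a y\<bar> \<le> B + 1" if "y \<in> space M" for y
        using gB[OF that] B0 by (auto simp: \<phi>_def indicator_def)
    qed (unfold \<phi>_def, measurable)
    have "(\<integral>y. H (merge {j} ?L (x, y)) \<partial>PiM ?L (\<lambda>_. M))
        = (\<integral>y. (D (x j))\<^sup>2 * (\<Prod>a\<in>?L. indicator (S (x j) a) (y a)) - (\<Prod>a\<in>?L. \<phi> (x j) a (y a)) \<partial>PiM ?L (\<lambda>_. M))"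
      by (rule Bochner_Integration.integral_cong[OF refl Hm])
    also have "\<dots> = (D (x j))\<^sup>2 * (\<Prod>a\<in>?L. prob (S (x j) a)) - (\<Prod>a\<in>?L. \<integral>y. \<phi> (x j) a y \<partial>M)"
      using P.product_integrable_prod[OF finL int1] P.product_integrable_prod[OF finL int2]
        P.product_integral_prod[OF finL int1] P.product_integral_prod[OF finL int2]
      by (simp add: Int_absorb1[OF sets.sets_into_space[OF S]])
    also have "\<dots> \<ge> 0"
    proof -
      have "(\<Prod>a\<in>?L. \<integral>y. \<phi> (x j) a y \<partial>M) \<le> (\<Prod>a\<in>?L. \<bar>\<integral>y. \<phi> (x j) a y \<partial>M\<bar>)"
        by (metis abs_ge_self abs_prod)
      \<comment> \<open>Coordinates \<open>i\<close> and \<open>k\<close> contribute a factor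
        \<open>D (x j)\<close> each, by \<open>less\<close> or \<open>le\<close>; the others
        contribute their probabilities only.\<close>
      also have "\<dots> \<le> (\<Prod>a\<in>?L. (if a \<in> {i, k} then D (x j) else 1) * prob (S (x j) a))"
      proof (rule prod_mono, intro conjI)
        fix a assume "a \<in> ?L"
        show "\<bar>\<integral>y. \<phi> (x j) a y \<partial>M\<bar> \<le> (if a \<in> {i, k} then D (x j) else 1) * prob (S (x j) a)"
        proof (cases "a \<in> {i, k}")
          case True
          then have aI: "a \<in> I" using ik by auto
          then have "S (x j) a = (if a < j then {y \<in> space M. f y \<le> f (x j)} else {y \<in> space M. f y < f (x j)})"
            unfolding S_def by auto
          then show ?thesis using True less[OF x] le[OF x] unfolding \<phi>_def by auto
        next
          case False
          then show ?thesis
            by (simp add: \<phi>_def Int_absorb1[OF sets.sets_into_space[OF S]])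
        qed
      qed simp
      also have "\<dots> = (D (x j))\<^sup>2 * (\<Prod>a\<in>?L. prob (S (x j) a))"
        unfolding prod.distrib prod_D by (simp add: power2_eq_square)
      finally show ?thesis by simp
    qed
    finally show "0 \<le> (\<integral>y. H (merge {j} ?L (x, y)) \<partial>PiM ?L (\<lambda>_. M))" .
  qed
  also have "\<dots> = (\<integral>X. H X \<partial>PiM ({j} \<union> ?L) (\<lambda>_. M))"
    using finL by (intro P.product_integral_fold[symmetric] intH) auto
  also have "\<dots> = (\<integral>X. H X \<partial>PiM K (\<lambda>_. M))"
    using j by (simp add: insert_absorb)
  also have "\<dots> = (\<integral>X. E X * (D (X j))\<^sup>2 \<partial>PiM K (\<lambda>_. M)) - (\<integral>X. E X * (g (X i) * g (X k)) \<partial>PiM K (\<lambda>_. M))"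
    unfolding H_def by (rule Bochner_Integration.integral_diff[OF intG intF])
  finally show ?thesis unfolding E_def by simp
qed

end

context
  fixes M :: "'a measure" and f g D :: "'a \<Rightarrow> real" and l m :: nat and B C :: real
  assumes prob: "prob_space M" and f[measurable]: "f \<in> borel_measurable M"
    and g[measurable]: "g \<in> borel_measurable M" and D[measurable]: "D \<in> borel_measurable M"
    and m: "1 \<le> m" "m < l"
    and fB: "\<And>x. x \<in> space M \<Longrightarrow> \<bar>f x\<bar> \<le> B"
    and gB: "\<And>x. x \<in> space M \<Longrightarrow> \<bar>g x\<bar> \<le> B"
    and D0: "\<And>x. x \<in> space M \<Longrightarrow> 0 \<le> D x"
    and DB: "\<And>x. x \<in> space M \<Longrightarrow> D x \<le> B"
    and C0: "0 \<le> C"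
    and gf: "\<And>x. x \<in> space M \<Longrightarrow> (g x)\<^sup>2 \<le> C * f x"
    and less: "\<And>x. x \<in> space M \<Longrightarrow>
       \<bar>\<integral>y. indicator {y \<in> space M. f y < f x} y * g y \<partial>M\<bar> \<le> D x * measure M {y \<in> space M. f y < f x}"
    and le: "\<And>x. x \<in> space M \<Longrightarrow>
       \<bar>\<integral>y. indicator {y \<in> space M. f y \<le> f x} y * g y \<partial>M\<bar> \<le> D x * measure M {y \<in> space M. f y \<le> f x}"
begin

interpretation prob_space M by (rule prob)

interpretation P: product_prob_space "\<lambda>_::nat. M" "{1..l}"
  by unfold_locales

abbreviation (input) "event j I X \<equiv> (of_bool (I = predecessors {1..l} (\<lambda>i. f (X i)) j) :: real)"

lemma integrable_event_mult:
  fixes h :: "(nat \<Rightarrow> 'a) \<Rightarrow> real"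
  assumes "I \<subseteq> {1..l} - {j}" "j \<in> {1..l}"
    and h: "h \<in> borel_measurable (PiM {1..l} (\<lambda>_. M))"
    and hb: "\<And>X. X \<in> space (PiM {1..l} (\<lambda>_. M)) \<Longrightarrow> \<bar>h X\<bar> \<le> b"
  shows "integrable (PiM {1..l} (\<lambda>_. M)) (\<lambda>X. event j I X * h X)"
proof (rule P.integrable_bounded)
  show "(\<lambda>X. event j I X * h X) \<in> borel_measurable (PiM {1..l} (\<lambda>_. M))"
    using measurable_of_bool_predecessors[OF prob f _ assms(1,2)] h by (intro borel_measurable_times) auto
  show "\<bar>event j I X * h X\<bar> \<le> b" if "X \<in> space (PiM {1..l} (\<lambda>_. M))" for X
    using hb[OF that] by auto
qed

text \<open>Expand the square. On the event, predecessors of \<open>j\<close> have no larger value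
  than \<open>j\<close>, so by \<open>gf\<close> each of the \<open>m\<close> diagonal terms is at
  most \<open>C * f (X j)\<close>. The off-diagonal terms, at most m^2 in number, fall under
  \<open>expectation_cross_term_le\<close>. Division by m^2 leaves a factor 1/m on the diagonal part
  only.\<close>

lemma second_moment_event_le:
  assumes I: "I \<subseteq> {1..l} - {j}" and j: "j \<in> {1..l}" and card: "card I = m"
  shows "(\<integral>X. event j I X * ((1 / real m) * (\<Sum>i\<in>I. g (X i)))\<^sup>2 \<partial>PiM {1..l} (\<lambda>_. M))
    \<le> (\<integral>X. event j I X * ((D (X j))\<^sup>2 + C / real m * f (X j)) \<partial>PiM {1..l} (\<lambda>_. M))"
proof -
  let ?P = "PiM {1..l} (\<lambda>_. M)"
  let ?E = "event j I"
  have B0: "0 \<le> B"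
    using D0 DB not_empty by (metis all_not_in_conv order_trans)
  have finI: "finite I" using I finite_subset by blast
  have sp: "X i \<in> space M" if "X \<in> space ?P" "i \<in> {1..l}" for X i
    using that by (auto simp: space_PiM)
  have meas[measurable]: "(\<lambda>X. X i) \<in> measurable ?P M" if "i \<in> {1..l}" for i
    using that by (rule measurable_component_singleton)
  have IK: "i \<in> {1..l}" if "i \<in> I" for i using that I by auto
  have int_gg: "integrable ?P (\<lambda>X. ?E X * (g (X i) * g (X k)))" if "i \<in> I" "k \<in> I" for i k
  proof (rule integrable_event_mult[OF I j, where b = "B * B"])
    show "(\<lambda>X. g (X i) * g (X k)) \<in> borel_measurable ?P"
      using meas[OF IK[OF that(1)]] meas[OF IK[OF that(2)]] by measurable
    show "\<bar>g (X i) * g (X k)\<bar> \<le> B * B" if "X \<in> space ?P" for X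
      unfolding abs_mult using gB sp[OF that] IK \<open>i \<in> I\<close> \<open>k \<in> I\<close> B0 by (intro mult_mono) auto
  qed
  have int_D: "integrable ?P (\<lambda>X. ?E X * (D (X j))\<^sup>2)"
  proof (rule integrable_event_mult[OF I j, where b = "B\<^sup>2"])
    show "(\<lambda>X. (D (X j))\<^sup>2) \<in> borel_measurable ?P"
      using meas[OF j] by measurable
    show "\<bar>(D (X j))\<^sup>2\<bar> \<le> B\<^sup>2" if "X \<in> space ?P" for X
      using D0 DB sp[OF that j] by (auto intro!: power_mono)
  qed
  have int_f: "integrable ?P (\<lambda>X. ?E X * f (X j))"
  proof (rule integrable_event_mult[OF I j, where b = B])
    show "(\<lambda>X. f (X j)) \<in> borel_measurable ?P"
      using meas[OF j] by measurable
  qed (use fB sp j in auto)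
  have diag: "(\<integral>X. ?E X * (g (X i) * g (X i)) \<partial>?P) \<le> C * (\<integral>X. ?E X * f (X j) \<partial>?P)" if "i \<in> I" for i
  proof -
    have "(\<integral>X. ?E X * (g (X i) * g (X i)) \<partial>?P) \<le> (\<integral>X. C * (?E X * f (X j)) \<partial>?P)"
    proof (rule integral_mono[OF int_gg[OF that that]])
      fix X assume X: "X \<in> space ?P"
      have "g (X i) * g (X i) \<le> C * f (X j)" if "I = predecessors {1..l} (\<lambda>i. f (X i)) j"
      proof -
        have "f (X i) \<le> f (X j)"
          using that \<open>i \<in> I\<close> by (auto simp: predecessors_def lex_less_def)
        then show ?thesis
          using gf[OF sp[OF X IK[OF \<open>i \<in> I\<close>]]] mult_left_mono[OF _ C0] by (fastforce simp: power2_eq_square)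
      qed
      then show "?E X * (g (X i) * g (X i)) \<le> C * (?E X * f (X j))" by auto
    qed (use int_f in simp)
    then show ?thesis by simp
  qed
  have D_nonneg: "0 \<le> (\<integral>X. ?E X * (D (X j))\<^sup>2 \<partial>?P)" by simp
  have row: "(\<Sum>k\<in>I. \<integral>X. ?E X * (g (X i) * g (X k)) \<partial>?P)
      \<le> C * (\<integral>X. ?E X * f (X j) \<partial>?P) + real m * (\<integral>X. ?E X * (D (X j))\<^sup>2 \<partial>?P)" if i: "i \<in> I" for i
  proof -
    have "(\<Sum>k\<in>I. \<integral>X. ?E X * (g (X i) * g (X k)) \<partial>?P)
      = (\<integral>X. ?E X * (g (X i) * g (X i)) \<partial>?P) + (\<Sum>k\<in>I - {i}. \<integral>X. ?E X * (g (X i) * g (X k)) \<partial>?P)"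
      by (rule sum.remove[OF finI i])
    also have "\<dots> \<le> C * (\<integral>X. ?E X * f (X j) \<partial>?P) + (\<Sum>k\<in>I - {i}. \<integral>X. ?E X * (D (X j))\<^sup>2 \<partial>?P)"
      using i by (intro add_mono diag sum_mono expectation_cross_term_le[OF prob f _ g gB D D0 DB less le j I]) auto
    also have "(\<Sum>k\<in>I - {i}. \<integral>X. ?E X * (D (X j))\<^sup>2 \<partial>?P) \<le> real m * (\<integral>X. ?E X * (D (X j))\<^sup>2 \<partial>?P)"
      using D_nonneg finI i card by (simp add: mult_right_mono del: Bochner_Integration.integral_mult_left_zero)
    finally show ?thesis by simp
  qed
  have "(\<integral>X. ?E X * ((1 / real m) * (\<Sum>i\<in>I. g (X i)))\<^sup>2 \<partial>?P)
      = (\<integral>X. (1 / (real m)\<^sup>2) * (\<Sum>i\<in>I. \<Sum>k\<in>I. ?E X * (g (X i) * g (X k))) \<partial>?P)"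
    by (intro Bochner_Integration.integral_cong refl)
       (simp add: power2_eq_square sum_product sum_distrib_left mult_ac)
  also have "\<dots> = (1 / (real m)\<^sup>2) * (\<Sum>i\<in>I. \<Sum>k\<in>I. \<integral>X. ?E X * (g (X i) * g (X k)) \<partial>?P)"
    using int_gg by (simp add: Bochner_Integration.integral_sum Bochner_Integration.integrable_sum)
  also have "\<dots> \<le> (1 / (real m)\<^sup>2) * (\<Sum>i\<in>I. C * (\<integral>X. ?E X * f (X j) \<partial>?P) + real m * (\<integral>X. ?E X * (D (X j))\<^sup>2 \<partial>?P))"
    by (intro mult_left_mono sum_mono row) auto
  also have "\<dots> = (\<integral>X. ?E X * (D (X j))\<^sup>2 \<partial>?P) + C / real m * (\<integral>X. ?E X * f (X j) \<partial>?P)"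
    using m card by (simp add: field_simps power2_eq_square)
  also have "\<dots> = (\<integral>X. ?E X * (D (X j))\<^sup>2 + C / real m * (?E X * f (X j)) \<partial>?P)"
    using int_D int_f by simp
  also have "\<dots> = (\<integral>X. ?E X * ((D (X j))\<^sup>2 + C / real m * f (X j)) \<partial>?P)"
    by (intro Bochner_Integration.integral_cong refl) (simp add: algebra_simps)
  finally show ?thesis .
qed

text \<open>\<open>sum_over_ranked_srt\<close> is used twice: it splits the left integral into the
  events of \<open>second_moment_event_le\<close>, and it reassembles the bounds, which involve only
  the point at position \<open>m\<close>, into one integral.\<close>

lemma second_moment_mean_selected_le:
  shows "(\<integral>X. ((1 / real m) * (\<Sum>i=1..m. g (X (sort_key (\<lambda>j. f (X j)) [1..<Suc l] ! (i - 1)))))\<^sup>2 \<partial>PiM {1..l} (\<lambda>_. M))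
    \<le> (\<integral>X. (D (X (sort_key (\<lambda>j. f (X j)) [1..<Suc l] ! m)))\<^sup>2
             + C / real m * f (X (sort_key (\<lambda>j. f (X j)) [1..<Suc l] ! m)) \<partial>PiM {1..l} (\<lambda>_. M))"
proof -
  let ?P = "PiM {1..l} (\<lambda>_. M)"
  let ?S = "\<lambda>j. {I. I \<subseteq> {1..l} - {j} \<and> card I = m}"
  have B0: "0 \<le> B"
    using D0 DB not_empty by (metis all_not_in_conv order_trans)
  have sp: "X i \<in> space M" if "X \<in> space ?P" "i \<in> {1..l}" for X i
    using that by (auto simp: space_PiM)
  have meas[measurable]: "(\<lambda>X. X i) \<in> measurable ?P M" if "i \<in> {1..l}" for i
    using that by (rule measurable_component_singleton)
  have int1: "integrable ?P (\<lambda>X. event j I X * ((1 / real m) * (\<Sum>i\<in>I. g (X i)))\<^sup>2)"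
    if "j \<in> {1..l}" "I \<in> ?S j" for j I
  proof (rule integrable_event_mult[where b = "B\<^sup>2"])
    show "(\<lambda>X. ((1 / real m) * (\<Sum>i\<in>I. g (X i)))\<^sup>2) \<in> borel_measurable ?P"
      using that by (intro borel_measurable_power borel_measurable_times borel_measurable_const
        borel_measurable_sum measurable_compose[OF _ g] meas) auto
    show "\<bar>((1 / real m) * (\<Sum>i\<in>I. g (X i)))\<^sup>2\<bar> \<le> B\<^sup>2" if X: "X \<in> space ?P" for X
    proof -
      have "\<bar>\<Sum>i\<in>I. g (X i)\<bar> \<le> (\<Sum>i\<in>I. B)"
        using \<open>I \<in> ?S j\<close> gB sp[OF X] by (intro order_trans[OF sum_abs] sum_mono) auto
      also have "\<dots> = real m * B" using \<open>I \<in> ?S j\<close> by simp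
      finally have "\<bar>(1 / real m) * (\<Sum>i\<in>I. g (X i))\<bar> \<le> B"
        using m by (simp add: abs_mult field_simps)
      then show ?thesis by (metis abs_ge_zero abs_power2 power2_abs power_mono)
    qed
  qed (use that in auto)
  have int2: "integrable ?P (\<lambda>X. event j I X * ((D (X j))\<^sup>2 + C / real m * f (X j)))"
    if "j \<in> {1..l}" "I \<in> ?S j" for j I
  proof (rule integrable_event_mult[where b = "B\<^sup>2 + C / real m * B"])
    show "(\<lambda>X. (D (X j))\<^sup>2 + C / real m * f (X j)) \<in> borel_measurable ?P"
      using meas[OF that(1)] by measurable
    show "\<bar>(D (X j))\<^sup>2 + C / real m * f (X j)\<bar> \<le> B\<^sup>2 + C / real m * B" if X: "X \<in> space ?P" for X
    proof -
      have "\<bar>C / real m * f (X j)\<bar> \<le> C / real m * B"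
        unfolding abs_mult using fB[OF sp[OF X \<open>j \<in> {1..l}\<close>]] C0 by (intro mult_mono) auto
      moreover have "\<bar>(D (X j))\<^sup>2\<bar> \<le> B\<^sup>2"
        using D0 DB sp[OF X \<open>j \<in> {1..l}\<close>] by (auto intro!: power_mono)
      ultimately show ?thesis by linarith
    qed
  qed (use that in auto)
  have "(\<integral>X. ((1 / real m) * (\<Sum>i=1..m. g (X (sort_key (\<lambda>j. f (X j)) [1..<Suc l] ! (i - 1)))))\<^sup>2 \<partial>?P)
     = (\<integral>X. (\<Sum>j\<in>{1..l}. \<Sum>I\<in>?S j. event j I X * ((1 / real m) * (\<Sum>i\<in>I. g (X i)))\<^sup>2) \<partial>?P)"
  proof (rule Bochner_Integration.integral_cong[OF refl])
    fix X
    show "((1 / real m) * (\<Sum>i=1..m. g (X (sort_key (\<lambda>j. f (X j)) [1..<Suc l] ! (i - 1)))))\<^sup>2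
      = (\<Sum>j\<in>{1..l}. \<Sum>I\<in>?S j. event j I X * ((1 / real m) * (\<Sum>i\<in>I. g (X i)))\<^sup>2)"
      using sum_take_srt[OF m(2), of "\<lambda>i. g (X i)" "\<lambda>j. f (X j)"]
        sum_over_ranked_srt[OF m(2), of "\<lambda>j I. ((1 / real m) * (\<Sum>i\<in>I. g (X i)))\<^sup>2" "\<lambda>j. f (X j)"]
      by (simp only:)
  qed
  also have "\<dots> = (\<Sum>j\<in>{1..l}. \<Sum>I\<in>?S j. \<integral>X. event j I X * ((1 / real m) * (\<Sum>i\<in>I. g (X i)))\<^sup>2 \<partial>?P)"
    by (subst Bochner_Integration.integral_sum, intro Bochner_Integration.integrable_sum int1, assumption+)
       (intro sum.cong refl Bochner_Integration.integral_sum int1)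
  also have "\<dots> \<le> (\<Sum>j\<in>{1..l}. \<Sum>I\<in>?S j. \<integral>X. event j I X * ((D (X j))\<^sup>2 + C / real m * f (X j)) \<partial>?P)"
    by (intro sum_mono second_moment_event_le) auto
  also have "\<dots> = (\<integral>X. (\<Sum>j\<in>{1..l}. \<Sum>I\<in>?S j. event j I X * ((D (X j))\<^sup>2 + C / real m * f (X j))) \<partial>?P)"
    by (subst Bochner_Integration.integral_sum, intro Bochner_Integration.integrable_sum int2, assumption+)
       (intro sum.cong refl Bochner_Integration.integral_sum[symmetric] int2)
  also have "\<dots> = (\<integral>X. (D (X (sort_key (\<lambda>j. f (X j)) [1..<Suc l] ! m)))\<^sup>2
             + C / real m * f (X (sort_key (\<lambda>j. f (X j)) [1..<Suc l] ! m)) \<partial>?P)"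
    by (intro Bochner_Integration.integral_cong refl sum_over_ranked_srt[OF m(2), symmetric])
  finally show ?thesis .
qed

end

section \<open>Moments of the selection threshold\<close>

text \<open>Cut the range of \<open>W\<close> into slabs of length 4 and sum the largest value on
  each slab times the tail probability at its lower end. The resulting constant does not involve
  \<open>B\<close>, hence will be uniform in the sample size.\<close>

lemma (in prob_space) expectation_powr_le_of_exp_tail:
  fixes W :: "'a \<Rightarrow> real"
  assumes W[measurable]: "W \<in> borel_measurable M"
    and W0: "\<And>x. x \<in> space M \<Longrightarrow> 0 \<le> W x" and WB: "\<And>x. x \<in> space M \<Longrightarrow> W x \<le> B"
    and q: "0 < q"
    and tail: "\<And>s::nat. 1 \<le> s \<Longrightarrow> prob {x \<in> space M. 4 * real s < W x} \<le> exp (- real s)"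
  shows "expectation (\<lambda>x. W x powr q) \<le> (\<Sum>s. (4 * (real s + 1)) powr q * exp (- real s))"
proof -
  \<comment> \<open>Only slabs with \<open>s < n\<close> meet the positive range of
    \<open>W\<close>, so the exchange of sum and expectation is a finite one.\<close>
  obtain n :: nat where n: "B \<le> real n" using real_arch_simple by blast
  have sm: "summable (\<lambda>s::nat. (4 * (real s + 1)) powr q * exp (- real s))"
  proof (rule summable_comparison_test_bigo)
    show "summable (\<lambda>n. norm (exp (- real n / 2)))"
      using summable_geometric[of "exp (- 1 / 2) :: real"] by (simp add: exp_of_nat_mult[symmetric])
    show "(\<lambda>s::nat. (4 * (real s + 1)) powr q * exp (- real s)) \<in> O(\<lambda>n. exp (- real n / 2))"
      by real_asymp
  qed
  have "expectation (\<lambda>x. W x powr q)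
      \<le> expectation (\<lambda>x. \<Sum>s<n. (4 * (real s + 1)) powr q * indicator {x \<in> space M. 4 * real s < W x} x)"
  proof (rule integral_mono)
    show "integrable M (\<lambda>x. W x powr q)"
      using W0 WB q by (intro integrable_bounded[where B = "B powr q"]) (auto intro!: powr_mono2)
    show "integrable M (\<lambda>x. \<Sum>s<n. (4 * (real s + 1)) powr q * indicator {x \<in> space M. 4 * real s < W x} x)"
      by (intro Bochner_Integration.integrable_sum integrable_mult_right integrable_bounded[where B = 1]) auto
    fix x assume x: "x \<in> space M"
    show "W x powr q \<le> (\<Sum>s<n. (4 * (real s + 1)) powr q * indicator {x \<in> space M. 4 * real s < W x} x)"
    proof (cases "W x = 0")
      case True
      then show ?thesis by (simp add: sum_nonneg)
    next
      case False
      then have pos: "0 < W x" using W0[OF x] by simp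
      \<comment> \<open>The slab of \<open>W x\<close>, open at the left and closed at the right.
        For positive \<open>W x\<close> the ceiling is at least 1, so \<open>nat\<close> truncates
        nothing.\<close>
      define s where "s = nat (\<lceil>W x / 4\<rceil> - 1)"
      have ceil: "\<lceil>W x / 4\<rceil> \<ge> 1" using pos by simp
      have s: "real s = of_int \<lceil>W x / 4\<rceil> - 1" unfolding s_def using ceil by simp
      have "real s < W x / 4 \<and> W x / 4 \<le> real s + 1"
        unfolding s using ceiling_correct[of "W x / 4"] by linarith
      then have s1: "4 * real s < W x" "W x \<le> 4 * (real s + 1)"
        by auto
      have "s < n" using s1(1) WB[OF x] n by linarith
      have "W x powr q \<le> (4 * (real s + 1)) powr q"
        using s1 pos q by (intro powr_mono2) auto
      also have "\<dots> = (4 * (real s + 1)) powr q * indicator {x \<in> space M. 4 * real s < W x} x"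
        using s1 x by simp
      also have "\<dots> \<le> (\<Sum>s<n. (4 * (real s + 1)) powr q * indicator {x \<in> space M. 4 * real s < W x} x)"
        using \<open>s < n\<close> by (intro member_le_sum) auto
      finally show ?thesis .
    qed
  qed
  also have "\<dots> = (\<Sum>s<n. (4 * (real s + 1)) powr q * prob {x \<in> space M. 4 * real s < W x})"
    by (subst Bochner_Integration.integral_sum) (auto intro!: integrable_bounded[where B = 1] sum.cong arg_cong[where f = prob])
  also have "\<dots> \<le> (\<Sum>s<n. (4 * (real s + 1)) powr q * exp (- real s))"
  proof (intro sum_mono mult_left_mono)
    \<comment> \<open>For \<open>s = 0\<close> the bound is 1 and holds for any probability;
      \<open>tail\<close> covers the rest.\<close>
    show "prob {x \<in> space M. 4 * real s < W x} \<le> exp (- real s)" for s :: nat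
      using tail[of s] by (cases "s = 0") auto
  qed auto
  also have "\<dots> \<le> (\<Sum>s. (4 * (real s + 1)) powr q * exp (- real s))"
    by (rule sum_le_suminf[OF sm]) auto
  finally show ?thesis .
qed

context
  fixes M :: "'a measure" and f :: "'a \<Rightarrow> real" and l m :: nat
  assumes prob: "prob_space M" and f[measurable]: "f \<in> borel_measurable M" and m: "m < l"
begin

interpretation prob_space M by (rule prob)

interpretation P: product_prob_space "\<lambda>_::nat. M" "{1..l}"
  by unfold_locales

text \<open>Chernoff bound. If the value at position \<open>m\<close> exceeds \<open>c\<close>, then
  the number N of points with value at most \<open>c\<close> is at most \<open>m\<close>, so exp (m
  - N) is at least 1. Its expectation factorizes by independence.\<close>

lemma tail_threshold_le:
  assumes meas: "(\<lambda>X. f (X (sort_key (\<lambda>j. f (X j)) [1..<Suc l] ! m))) \<in> borel_measurable (PiM {1..l} (\<lambda>_. M))"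
  shows "measure (PiM {1..l} (\<lambda>_. M))
      {X \<in> space (PiM {1..l} (\<lambda>_. M)). c < f (X (sort_key (\<lambda>j. f (X j)) [1..<Suc l] ! m))}
    \<le> exp (real m - real l * prob {x \<in> space M. f x \<le> c} / 2)"
proof -
  let ?P = "PiM {1..l} (\<lambda>_. M)"
  let ?p = "prob {x \<in> space M. f x \<le> c}"
  define A where "A = {x \<in> space M. f x \<le> c}"
  define S where "S = {X \<in> space ?P. c < f (X (sort_key (\<lambda>j. f (X j)) [1..<Suc l] ! m))}"
  have A[measurable]: "A \<in> sets M" unfolding A_def by measurable
  have S[measurable]: "S \<in> sets ?P" unfolding S_def using meas by measurable
  \<comment> \<open>Gives 1 - exp (-1) \<ge> 1/2, the source of the factor 1/2 in the
    exponent.\<close>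
  have e: "exp (-1 :: real) \<le> 1 / 2"
    using exp_ge_add_one_self[of 1] by (simp add: exp_minus field_simps)
  have intA: "integrable M (\<lambda>x. exp (- indicator A x) :: real)"
    by (intro integrable_bounded[where B = 1]) (auto simp: indicator_def)
  have "measure ?P S = (\<integral>X. indicator S X \<partial>?P)"
    using sets.sets_into_space[OF S] by (simp add: Int_absorb2)
  also have "\<dots> \<le> (\<integral>X. exp (real m) * (\<Prod>i\<in>{1..l}. exp (- indicator A (X i))) \<partial>?P)"
  proof (rule integral_mono)
    show "integrable ?P (indicator S :: _ \<Rightarrow> real)"
      using borel_measurable_indicator[OF S]
      by (rule P.integrable_bounded[where B = 1]) (auto simp: indicator_def)
    show "integrable ?P (\<lambda>X. exp (real m) * (\<Prod>i\<in>{1..l}. exp (- indicator A (X i))))"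
      by (intro integrable_mult_right P.product_integrable_prod intA) auto
    fix X assume X: "X \<in> space ?P"
    show "indicator S X \<le> exp (real m) * (\<Prod>i\<in>{1..l}. exp (- indicator A (X i)))"
    proof (cases "X \<in> S")
      case True
      have "(\<Sum>i\<in>{1..l}. indicator A (X i)) = real (card {i \<in> {1..l}. f (X i) \<le> c})"
      proof -
        have "(\<Sum>i\<in>{1..l}. indicator A (X i)) = (\<Sum>i\<in>{1..l}. if f (X i) \<le> c then 1 else (0::real))"
          using X by (intro sum.cong) (auto simp: A_def space_PiM indicator_def)
        also have "\<dots> = real (card {i \<in> {1..l}. f (X i) \<le> c})"
          by (simp add: sum.If_cases Int_def)
        finally show ?thesis .
      qed
      also have "\<dots> \<le> real m"
        using card_le_threshold_srt[OF m, of c "\<lambda>j. f (X j)"] True by (simp add: S_def)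
      finally have "1 \<le> exp (real m - (\<Sum>i\<in>{1..l}. indicator A (X i)))" by simp
      also have "\<dots> = exp (real m) * (\<Prod>i\<in>{1..l}. exp (- indicator A (X i)))"
        by (simp add: exp_add[symmetric] exp_sum[symmetric] sum_negf)
      finally show ?thesis using True by simp
    qed (simp add: prod_nonneg)
  qed
  also have "\<dots> = exp (real m) * (\<Prod>i\<in>{1..l}. \<integral>x. exp (- indicator A x) \<partial>M)"
    using P.product_integral_prod[of "{1..l}" "\<lambda>_ x. exp (- indicator A x) :: real"] intA by simp
  also have "\<dots> \<le> exp (real m) * (\<Prod>i\<in>{1..l}. exp (- ?p / 2))"
  proof (intro mult_left_mono prod_mono conjI)
    have "(\<integral>x. exp (- indicator A x) \<partial>M) = (\<integral>x. 1 - (1 - exp (-1)) * indicator A x \<partial>M)"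
      by (intro Bochner_Integration.integral_cong) (auto simp: indicator_def)
    also have "\<dots> = 1 - (1 - exp (-1)) * prob A"
    proof -
      have "integrable M (indicator A :: _ \<Rightarrow> real)"
        by (intro integrable_bounded[where B = 1]) (auto simp: indicator_def)
      then show ?thesis using sets.sets_into_space[OF A] by (simp add: prob_space Int_absorb1)
    qed
    also have "\<dots> \<le> 1 - (1 / 2) * prob A"
      using e by (intro diff_mono mult_right_mono) auto
    also have "\<dots> \<le> exp (- prob A / 2)"
      using exp_ge_add_one_self[of "- prob A / 2"] by simp
    finally show "(\<integral>x. exp (- indicator A x) \<partial>M) \<le> exp (- ?p / 2)" by (simp add: A_def)
  qed auto
  also have "\<dots> = exp (real m - real l * ?p / 2)"
    by (simp add: exp_of_nat_mult[symmetric] exp_add[symmetric])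
  finally show ?thesis by (simp add: S_def)
qed

text \<open>Multiplied by \<kappa> l / m, the power \<beta> of the threshold has an exponential tail
  uniformly in \<open>l\<close> and \<open>m\<close>. Undoing this scaling produces the power of m /
  l, with a constant depending only on \<open>q\<close>, \<open>\<beta>\<close> and
  \<open>\<kappa>\<close>.\<close>

lemma moment_threshold_le:
  assumes meas: "(\<lambda>X. f (X (sort_key (\<lambda>j. f (X j)) [1..<Suc l] ! m))) \<in> borel_measurable (PiM {1..l} (\<lambda>_. M))"
    and m1: "1 \<le> m" and \<beta>: "0 < \<beta>" and \<kappa>: "0 < \<kappa>" and q: "0 < q"
    and f0: "\<And>x. x \<in> space M \<Longrightarrow> 0 \<le> f x" and fB: "\<And>x. x \<in> space M \<Longrightarrow> f x \<le> B"
    and vol: "\<And>c. 0 < c \<Longrightarrow> c \<le> B \<Longrightarrow> \<kappa> * c powr \<beta> \<le> prob {x \<in> space M. f x \<le> c}"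
  shows "(\<integral>X. f (X (sort_key (\<lambda>j. f (X j)) [1..<Suc l] ! m)) powr q \<partial>PiM {1..l} (\<lambda>_. M))
    \<le> (\<Sum>s. (4 * (real s + 1)) powr (q / \<beta>) * exp (- real s)) / \<kappa> powr (q / \<beta>) * (real m / real l) powr (q / \<beta>)"
proof -
  let ?P = "PiM {1..l} (\<lambda>_. M)"
  define h where "h X = f (X (sort_key (\<lambda>j. f (X j)) [1..<Suc l] ! m))" for X
  have h[measurable]: "h \<in> borel_measurable ?P" using meas by (simp add: h_def[abs_def])
  have sp: "X (sort_key (\<lambda>j. f (X j)) [1..<Suc l] ! m) \<in> space M" if "X \<in> space ?P" for X
    using that srt_in[OF m, of "\<lambda>j. f (X j)"] by (auto simp: space_PiM simp del: upt_Suc)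
  have h0: "0 \<le> h X" and hB: "h X \<le> B" if "X \<in> space ?P" for X
    using f0 fB sp[OF that] by (auto simp: h_def)
  define a where "a = \<kappa> * real l / real m"
  have a: "0 < a" using \<kappa> m m1 by (simp add: a_def)
  define W where "W X = a * h X powr \<beta>" for X
  have tail: "P.prob {X \<in> space ?P. 4 * real s < W X} \<le> exp (- real s)" if s: "1 \<le> s" for s
  proof -
    \<comment> \<open>Chosen so that \<kappa> l c^\<beta> = 4 s m. The Chernoff exponent is then at
      most m - 2 s m, which is at most -s because \<open>s\<close> and \<open>m\<close> are at least
      1.\<close>
    define c where "c = (4 * real s / a) powr (1 / \<beta>)"
    have c0: "0 < c" using s a by (simp add: c_def)
    have c\<beta>: "c powr \<beta> = 4 * real s / a" using s a \<beta> by (simp add: c_def powr_powr)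
    have iff: "4 * real s < W X \<longleftrightarrow> c < h X" if "X \<in> space ?P" for X
    proof -
      have "4 * real s < W X \<longleftrightarrow> c powr \<beta> < h X powr \<beta>"
        unfolding c\<beta> W_def using a by (simp add: field_simps)
      also have "\<dots> \<longleftrightarrow> c < h X"
        using h0[OF that] c0 \<beta> by (metis less_eq_real_def not_le powr_less_mono2 powr_mono2 powr_ge_zero)
      finally show ?thesis .
    qed
    have eq: "{X \<in> space ?P. 4 * real s < W X} = {X \<in> space ?P. c < h X}" using iff by auto
    show ?thesis
    proof (cases "c \<le> B")
      case True
      have "P.prob {X \<in> space ?P. c < h X} \<le> exp (real m - real l * prob {x \<in> space M. f x \<le> c} / 2)"
        unfolding h_def by (rule tail_threshold_le[OF meas])
      also have "\<dots> \<le> exp (real m - real l * (\<kappa> * c powr \<beta>) / 2)"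
        using vol[OF c0 True] by (auto intro!: mult_left_mono)
      also have "real l * (\<kappa> * c powr \<beta>) / 2 = 2 * real s * real m"
        unfolding c\<beta> a_def using m m1 \<kappa> by (simp add: field_simps)
      also have "exp (real m - 2 * real s * real m) \<le> exp (- real s)"
      proof -
        have "real s * 1 \<le> real s * real m" "1 * real m \<le> real s * real m"
          using s m1 by (auto intro!: mult_left_mono mult_right_mono)
        then show ?thesis by simp
      qed
      finally show ?thesis unfolding eq .
    next
      case False
      \<comment> \<open>Beyond the range covered by \<open>vol\<close> the tail event is empty, as
        no value exceeds \<open>B\<close>.\<close>
      then have "{X \<in> space ?P. c < h X} = {}" using hB by force
      then show ?thesis unfolding eq by (metis measure_empty exp_ge_zero)
    qed
  qed
  have "P.expectation (\<lambda>X. W X powr (q / \<beta>)) \<le> (\<Sum>s. (4 * (real s + 1)) powr (q / \<beta>) * exp (- real s))"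
  proof (rule P.expectation_powr_le_of_exp_tail[OF _ _ _ _ tail])
    show "W \<in> borel_measurable ?P" unfolding W_def[abs_def] by measurable
    show "0 \<le> W X" for X using a by (simp add: W_def)
    show "W X \<le> a * B powr \<beta>" if "X \<in> space ?P" for X
      unfolding W_def using h0[OF that] hB[OF that] a \<beta> by (intro mult_left_mono powr_mono2) auto
  qed (use q \<beta> in auto)
  also have "(\<lambda>X. W X powr (q / \<beta>)) = (\<lambda>X. a powr (q / \<beta>) * h X powr q)"
    using a \<beta> by (auto simp: W_def powr_mult powr_powr)
  finally have "a powr (q / \<beta>) * P.expectation (\<lambda>X. h X powr q) \<le> (\<Sum>s. (4 * (real s + 1)) powr (q / \<beta>) * exp (- real s))"
    by simp
  then have "P.expectation (\<lambda>X. h X powr q) \<le> (\<Sum>s. (4 * (real s + 1)) powr (q / \<beta>) * exp (- real s)) / a powr (q / \<beta>)"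
    using a by (simp add: field_simps)
  also have "a powr (q / \<beta>) = \<kappa> powr (q / \<beta>) / (real m / real l) powr (q / \<beta>)"
    using m m1 \<kappa> by (simp add: a_def powr_mult powr_divide)
  finally show ?thesis by (simp add: h_def)
qed

end

section \<open>Ellipsoids and the uniform distribution\<close>

lemma mat_norm_nonneg: "pos_def_matrix H \<Longrightarrow> 0 \<le> mat_norm H y"
  by (cases "y = 0") (auto simp: mat_norm_def pos_def_matrix_def less_imp_le)

lemma mat_norm_pos: "pos_def_matrix H \<Longrightarrow> y \<noteq> 0 \<Longrightarrow> 0 < mat_norm H y"
  by (auto simp: mat_norm_def pos_def_matrix_def)

lemma mat_norm_scaleR: "mat_norm H (c *\<^sub>R y) = \<bar>c\<bar> * mat_norm H y"
  by (simp add: mat_norm_def matrix_vector_mult_scaleR real_sqrt_mult mult.assoc[symmetric] flip: power2_eq_square)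

lemma continuous_on_mat_norm: "continuous_on S (mat_norm H)"
  unfolding mat_norm_def[abs_def] by (intro continuous_intros matrix_vector_mult_linear_continuous_on)

text \<open>\<open>mat_norm H\<close> attains a positive minimum and a maximum on the compact unit
  sphere; homogeneity carries both over to all vectors.\<close>

lemma mat_norm_equiv_norm:
  fixes H :: "real ^ 'n ^ 'n"
  assumes "pos_def_matrix H"
  obtains a b where "0 < a" "0 < b"
    "\<And>y. a * norm y \<le> mat_norm H y" "\<And>y. mat_norm H y \<le> b * norm y"
proof -
  let ?S = "sphere (0 :: real ^ 'n) 1"
  have ne: "?S \<noteq> {}" by simp
  obtain y0 where y0: "y0 \<in> ?S" "\<And>y. y \<in> ?S \<Longrightarrow> mat_norm H y0 \<le> mat_norm H y"
    using continuous_attains_inf[OF compact_sphere ne continuous_on_mat_norm] by metis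
  obtain y1 where y1: "y1 \<in> ?S" "\<And>y. y \<in> ?S \<Longrightarrow> mat_norm H y \<le> mat_norm H y1"
    using continuous_attains_sup[OF compact_sphere ne continuous_on_mat_norm] by metis
  have eq: "mat_norm H y = mat_norm H (sgn y) * norm y" for y
    using mat_norm_scaleR[of H "norm y" "sgn y"] mat_norm_scaleR[of H 0 y]
    by (cases "y = 0") (simp_all add: sgn_div_norm)
  have sgn: "sgn y \<in> ?S" if "y \<noteq> 0" for y :: "real ^ 'n"
    using that by (simp add: norm_sgn)
  show thesis
  proof (rule that)
    show "0 < mat_norm H y0" "0 < mat_norm H y1"
      using y0(1) y1(1) by (auto intro!: mat_norm_pos[OF assms])
    show "mat_norm H y0 * norm y \<le> mat_norm H y" for y
      using y0(2)[OF sgn, of y] by (subst eq) (cases "y = 0"; auto intro: mult_right_mono)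
    show "mat_norm H y \<le> mat_norm H y1 * norm y" for y
      using y1(2)[OF sgn, of y] by (subst eq) (cases "y = 0"; auto intro: mult_right_mono)
  qed
qed

text \<open>For \<open>N = 0\<close> both sides vanish by the convention that
  \<open>0 powr x\<close> is 0 for every \<open>x\<close>.\<close>

lemma powr_eq_powr_minus_two_mult_power2: "0 \<le> N \<Longrightarrow> N powr \<alpha> = N powr (\<alpha> - 2) * N\<^sup>2" for N :: real
  by (cases "N = 0") (simp_all add: powr_diff)

definition ellipsoid :: "real ^ 'n ^ 'n \<Rightarrow> real ^ 'n \<Rightarrow> real \<Rightarrow> (real ^ 'n) set" where
  "ellipsoid H x \<rho> = {y. mat_norm H (y - x) \<le> \<rho>}"

lemma closed_ellipsoid: "closed (ellipsoid H x \<rho>)"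
  unfolding ellipsoid_def
  by (intro closed_Collect_le continuous_intros continuous_on_compose2[OF continuous_on_mat_norm[of UNIV]]) auto

text \<open>The homothety with center \<open>x\<close> and factor \<open>t\<close> maps one
  ellipsoid onto the other.\<close>

lemma measure_lborel_ellipsoid_scale:
  fixes x :: "real ^ 'n"
  assumes "0 < t"
  shows "measure lborel (ellipsoid H x (t * \<rho>)) = t ^ CARD('n) * measure lborel (ellipsoid H x \<rho>)"
proof -
  have "ellipsoid H x (t * \<rho>) = (\<lambda>y. t *\<^sub>R y + (1 - t) *\<^sub>R x) ` ellipsoid H x \<rho>"
  proof (intro set_eqI iffI)
    fix z assume z: "z \<in> ellipsoid H x (t * \<rho>)"
    define y where "y = x + (1 / t) *\<^sub>R (z - x)"
    have "mat_norm H (y - x) = mat_norm H (z - x) / t"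
      using assms by (simp add: y_def mat_norm_scaleR)
    then have "y \<in> ellipsoid H x \<rho>"
      using z assms by (simp add: ellipsoid_def pos_divide_le_eq mult.commute)
    moreover have "z = t *\<^sub>R y + (1 - t) *\<^sub>R x"
      using assms by (simp add: y_def algebra_simps)
    ultimately show "z \<in> (\<lambda>y. t *\<^sub>R y + (1 - t) *\<^sub>R x) ` ellipsoid H x \<rho>" by blast
  next
    fix z assume "z \<in> (\<lambda>y. t *\<^sub>R y + (1 - t) *\<^sub>R x) ` ellipsoid H x \<rho>"
    then obtain y where y: "y \<in> ellipsoid H x \<rho>" "z = t *\<^sub>R y + (1 - t) *\<^sub>R x" by blast
    have "z - x = t *\<^sub>R (y - x)" unfolding y(2) by (simp add: algebra_simps)
    then show "z \<in> ellipsoid H x (t * \<rho>)"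
      using y(1) assms by (simp add: ellipsoid_def mat_norm_scaleR)
  qed
  then have "measure lebesgue (ellipsoid H x (t * \<rho>)) = t ^ CARD('n) * measure lebesgue (ellipsoid H x \<rho>)"
    using measure_lebesgue_affine[of t "(1 - t) *\<^sub>R x" "ellipsoid H x \<rho>"] assms by simp
  \<comment> \<open>The affine image rule concerns Lebesgue measure. Ellipsoids are closed, hence
    Borel, and there both measures agree.\<close>
  moreover have "measure lebesgue (ellipsoid H x s) = measure lborel (ellipsoid H x s)" for s
    using borel_closed[OF closed_ellipsoid] by (intro measure_completion) simp
  ultimately show ?thesis by simp
qed

lemma integral_lborel_reflect:
  fixes \<phi> :: "'a::euclidean_space \<Rightarrow> real"
  assumes "\<phi> \<in> borel_measurable borel"
  shows "(\<integral>y. \<phi> (2 *\<^sub>R x - y) \<partial>lborel) = (\<integral>y. \<phi> y \<partial>lborel)"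
proof -
  have "lborel = distr lborel borel (\<lambda>y. 2 *\<^sub>R x - y)"
    using lborel_affine[of "-1" "2 *\<^sub>R x"] by (simp add: density_1)
  then have "(\<integral>y. \<phi> y \<partial>lborel) = (\<integral>y. \<phi> y \<partial>distr lborel borel (\<lambda>y. 2 *\<^sub>R x - y))"
    by simp
  also have "\<dots> = (\<integral>y. \<phi> (2 *\<^sub>R x - y) \<partial>lborel)"
    using assms by (intro integral_distr) auto
  finally show ?thesis by simp
qed

text \<open>The ellipsoid is invariant under the point reflection in \<open>x\<close>, while the
  integrand changes sign; so the integral equals its own negative.\<close>

lemma integral_ellipsoid_centered:
  "(\<integral>y. indicator (ellipsoid H x \<rho>) y * (y - x) $ c \<partial>lborel) = 0"
proof -
  let ?\<phi> = "\<lambda>y. indicator (ellipsoid H x \<rho>) y * (y - x) $ c"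
  have [measurable]: "ellipsoid H x \<rho> \<in> sets borel" by (rule borel_closed[OF closed_ellipsoid])
  have c: "(\<lambda>y. (y - x) $ c) \<in> borel_measurable borel"
    by (intro borel_measurable_continuous_onI continuous_intros)
  have "2 *\<^sub>R x - y \<in> ellipsoid H x \<rho> \<longleftrightarrow> y \<in> ellipsoid H x \<rho>" for y
  proof -
    have "2 *\<^sub>R x - y - x = (-1) *\<^sub>R (y - x)" by (simp add: algebra_simps scaleR_2)
    then show ?thesis unfolding ellipsoid_def mem_Collect_eq by (simp only: mat_norm_scaleR) simp
  qed
  then have "?\<phi> (2 *\<^sub>R x - y) = - ?\<phi> y" for y
    by (simp add: indicator_def scaleR_2)
  moreover have "(\<integral>y. ?\<phi> (2 *\<^sub>R x - y) \<partial>lborel) = (\<integral>y. ?\<phi> y \<partial>lborel)"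
    using c by (intro integral_lborel_reflect borel_measurable_times borel_measurable_indicator) measurable
  ultimately show ?thesis by simp
qed

section \<open>The uniform distribution on the ball as normalized Lebesgue measure\<close>

lemma sets_unif_cball_iff: "A \<in> sets (unif (cball 0 r)) \<longleftrightarrow> A \<subseteq> cball 0 r \<and> A \<in> sets borel"
  unfolding sets_unif by (subst sets_restrict_space_iff) auto

lemma space_unif: "space (unif S) = S"
  by (simp add: unif_def space_restrict_space)

lemma emeasure_restrict_cball:
  "A \<in> sets borel \<Longrightarrow> A \<subseteq> cball 0 r \<Longrightarrow> emeasure (restrict_space lborel (cball (0 :: real ^ 'n) r)) A = emeasure lborel A"
  by (subst emeasure_restrict_space) auto

lemma measure_unif_cball:
  fixes A :: "(real ^ 'n) set"
  assumes "A \<in> sets borel" "A \<subseteq> cball 0 r" "0 < r"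
  shows "measure (unif (cball 0 r)) A = measure lborel A / measure lborel (cball (0 :: real ^ 'n) r)"
proof -
  let ?S = "cball (0 :: real ^ 'n) r"
  have A: "A \<in> sets (restrict_space lborel ?S)"
    using assms by (subst sets_restrict_space_iff) auto
  have S: "emeasure (restrict_space lborel ?S) ?S = emeasure lborel ?S"
    by (rule emeasure_restrict_cball) auto
  have "emeasure lborel ?S \<noteq> 0"
    using content_cball_pos[OF assms(3), of "0 :: real ^ 'n"] by (auto simp: measure_def)
  then have "measure (unif ?S) A = measure (restrict_space lborel ?S) (?S \<inter> A) / measure (restrict_space lborel ?S) ?S"
    unfolding unif_def using A emeasure_lborel_cball_finite[of "0 :: real ^ 'n" r]
    by (intro measure_uniform_measure) (simp_all add: S)
  also have "?S \<inter> A = A" using assms by blast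
  also have "measure (restrict_space lborel ?S) A = measure lborel A"
    using emeasure_restrict_cball[OF assms(1,2)] by (simp add: measure_def)
  also have "measure (restrict_space lborel ?S) ?S = measure lborel ?S"
    using S by (simp add: measure_def)
  finally show ?thesis .
qed

lemma integral_unif_cball:
  fixes h :: "real ^ 'n \<Rightarrow> real"
  assumes h[measurable]: "h \<in> borel_measurable borel" and r: "0 < r"
  shows "(\<integral>y. h y \<partial>unif (cball 0 r)) =
    (\<integral>y. indicator (cball 0 r) y * h y \<partial>lborel) / measure lborel (cball (0 :: real ^ 'n) r)"
proof -
  let ?S = "cball (0 :: real ^ 'n) r" and ?V = "measure lborel (cball (0 :: real ^ 'n) r)"
  have V: "0 < ?V" using r by (rule content_cball_pos)
  have em: "emeasure (restrict_space lborel ?S) ?S = ennreal ?V"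
    using emeasure_restrict_cball[of ?S r] emeasure_lborel_cball_finite[of "0 :: real ^ 'n" r]
    by (simp add: emeasure_eq_ennreal_measure)
  have "unif ?S = density (restrict_space lborel ?S) (\<lambda>y. ennreal (1 / ?V))"
    unfolding unif_def uniform_measure_def em
  proof (rule density_cong)
    show "(\<lambda>y. indicator ?S y / ennreal ?V) \<in> borel_measurable (restrict_space lborel ?S)"
      by (intro measurable_restrict_space1 borel_measurable_divide_ennreal borel_measurable_indicator borel_measurable_const) simp
    show "AE y in restrict_space lborel ?S. indicator ?S y / ennreal ?V = ennreal (1 / ?V)"
      using V divide_ennreal[of 1 ?V] by (intro AE_I2) (simp add: space_restrict_space)
  qed simp
  then have "(\<integral>y. h y \<partial>unif ?S) = (\<integral>y. (1 / ?V) *\<^sub>R h y \<partial>restrict_space lborel ?S)"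
    using V by (simp only:) (subst integral_density; auto intro: measurable_restrict_space1)
  also have "\<dots> = (\<integral>y. indicator ?S y *\<^sub>R ((1 / ?V) *\<^sub>R h y) \<partial>lborel)"
    by (subst integral_restrict_space) auto
  also have "\<dots> = (\<integral>y. (indicator ?S y * h y) / ?V \<partial>lborel)"
    by (intro Bochner_Integration.integral_cong) auto
  finally show ?thesis by simp
qed

section \<open>Sublevel sets of the objective\<close>

context
  fixes r \<alpha> M :: real and f \<epsilon> :: "real ^ 'n \<Rightarrow> real" and xs :: "real ^ 'n" and H :: "real ^ 'n ^ 'n"
  assumes r: "0 < r" and cont: "continuous_on (cball 0 r) f" and \<alpha>: "2 < \<alpha>"
    and argmin: "\<And>x. is_arg_min f (\<lambda>y. y \<in> cball 0 r) x \<longleftrightarrow> x = xs"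
    and xs: "norm xs < r" and fxs: "f xs = 0"
    and H: "pos_def_matrix H" and M: "0 < M" and \<epsilon>: "\<And>y. \<bar>\<epsilon> y\<bar> \<le> M"
    and expansion: "\<And>x. x \<in> cball 0 r \<Longrightarrow>
      f x = mat_norm H (x - xs) ^ 2 + mat_norm H (x - xs) powr \<alpha> * \<epsilon> (x - xs)"
begin

section \<open>Comparison of the objective with its quadratic model\<close>

lemma objective_nonneg: "x \<in> cball 0 r \<Longrightarrow> 0 \<le> f x"
  using argmin[of xs] fxs unfolding is_arg_min_def by (auto simp: not_less)

text \<open>Another zero of \<open>f\<close> would be a second minimizer, against
  \<open>argmin\<close>.\<close>

lemma objective_pos: "x \<in> cball 0 r \<Longrightarrow> x \<noteq> xs \<Longrightarrow> 0 < f x"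
  using argmin[of xs] argmin[of x] objective_nonneg[of x] fxs unfolding is_arg_min_def
  by (metis less_eq_real_def)

text \<open>Splitting off a square from the power \<alpha> leaves a relative error of order
  R^(\<alpha>-2), small near the minimizer and bounded on the whole ball.\<close>

lemma objective_quadratic_error:
  assumes "x \<in> cball 0 r" "mat_norm H (x - xs) \<le> R"
  shows "\<bar>f x - (mat_norm H (x - xs))\<^sup>2\<bar> \<le> M * R powr (\<alpha> - 2) * (mat_norm H (x - xs))\<^sup>2"
proof -
  let ?N = "mat_norm H (x - xs)"
  have N: "0 \<le> ?N" by (rule mat_norm_nonneg[OF H])
  have "\<bar>f x - ?N\<^sup>2\<bar> = ?N powr (\<alpha> - 2) * ?N\<^sup>2 * \<bar>\<epsilon> (x - xs)\<bar>"
    using expansion[OF assms(1)] powr_eq_powr_minus_two_mult_power2[OF N, of \<alpha>]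
    by (simp add: abs_mult)
  also have "\<dots> \<le> R powr (\<alpha> - 2) * ?N\<^sup>2 * M"
    using assms(2) N \<alpha> M \<epsilon> by (intro mult_mono powr_mono2) auto
  finally show ?thesis by (simp add: mult_ac)
qed

lemma norm_diff_minimizer_le: "x \<in> cball 0 r \<Longrightarrow> norm (x - xs) \<le> 2 * r"
  using norm_triangle_ineq4[of x xs] xs by simp

lemma objective_upper:
  obtains K where "0 < K" "\<And>x. x \<in> cball 0 r \<Longrightarrow> f x \<le> K * (norm (x - xs))\<^sup>2"
proof -
  obtain a b where ab: "0 < a" "0 < b"
    "\<And>y. a * norm y \<le> mat_norm H y" "\<And>y. mat_norm H y \<le> b * norm y"
    using mat_norm_equiv_norm[OF H] by metis
  define T where "T = M * (b * (2 * r)) powr (\<alpha> - 2)"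
  have T: "0 \<le> T" using M by (simp add: T_def)
  show thesis
  proof (rule that[of "(1 + T) * b\<^sup>2"])
    show "0 < (1 + T) * b\<^sup>2" using T ab by (simp add: add_pos_nonneg)
    fix x :: "real ^ 'n" assume x: "x \<in> cball 0 r"
    have N: "mat_norm H (x - xs) \<le> b * norm (x - xs)" by (rule ab)
    also have "\<dots> \<le> b * (2 * r)" using norm_diff_minimizer_le[OF x] ab by simp
    finally have "f x \<le> (1 + T) * (mat_norm H (x - xs))\<^sup>2"
      using objective_quadratic_error[OF x] by (fastforce simp: T_def algebra_simps)
    also have "\<dots> \<le> (1 + T) * (b * norm (x - xs))\<^sup>2"
      using N T mat_norm_nonneg[OF H] by (intro mult_left_mono power_mono) auto
    finally show "f x \<le> (1 + T) * b\<^sup>2 * (norm (x - xs))\<^sup>2" by (simp add: power_mult_distrib)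
  qed
qed

lemma exists_small_radius:
  obtains \<rho>0 where "0 < \<rho>0" "M * \<rho>0 powr (\<alpha> - 2) \<le> 1 / 2"
proof (rule that[of "(1 / (2 * M)) powr (1 / (\<alpha> - 2))"])
  show "M * ((1 / (2 * M)) powr (1 / (\<alpha> - 2))) powr (\<alpha> - 2) \<le> 1 / 2"
    using M \<alpha> by (simp add: powr_powr)
qed (use M in simp)

text \<open>Within H-distance \<open>\<rho>0\<close> of the minimizer the relative error is at most
  1/2. The rest \<open>T\<close> of the ball is compact and avoids the minimizer, so
  \<open>f\<close> is bounded below there by some \<open>e > 0\<close>, which is compared with a
  bound R^2 for the squared norm.\<close>

lemma objective_lower:
  obtains k where "0 < k" "k \<le> 1" "\<And>x. x \<in> cball 0 r \<Longrightarrow> k * (mat_norm H (x - xs))\<^sup>2 \<le> f x"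
proof -
  obtain \<rho>0 where \<rho>0: "0 < \<rho>0" "M * \<rho>0 powr (\<alpha> - 2) \<le> 1 / 2" by (rule exists_small_radius)
  obtain a b where ab: "0 < a" "0 < b"
    "\<And>y. a * norm y \<le> mat_norm H y" "\<And>y. mat_norm H y \<le> b * norm y"
    using mat_norm_equiv_norm[OF H] by metis
  define T where "T = {x \<in> cball 0 r. \<rho>0 \<le> mat_norm H (x - xs)}"
  have near: "1 / 2 * (mat_norm H (x - xs))\<^sup>2 \<le> f x" if x: "x \<in> cball 0 r" "x \<notin> T" for x
  proof -
    have "\<bar>f x - (mat_norm H (x - xs))\<^sup>2\<bar> \<le> M * \<rho>0 powr (\<alpha> - 2) * (mat_norm H (x - xs))\<^sup>2"
      using x by (intro objective_quadratic_error) (auto simp: T_def)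
    also have "\<dots> \<le> 1 / 2 * (mat_norm H (x - xs))\<^sup>2"
      using \<rho>0(2) by (intro mult_right_mono) auto
    finally show ?thesis by linarith
  qed
  have T: "compact T"
  proof -
    have "closed {x. \<rho>0 \<le> mat_norm H (x - xs)}"
      by (intro closed_Collect_le continuous_intros continuous_on_compose2[OF continuous_on_mat_norm[of UNIV]]) auto
    then have "compact (cball 0 r \<inter> {x. \<rho>0 \<le> mat_norm H (x - xs)})"
      by (rule compact_Int_closed[OF compact_cball])
    then show ?thesis by (simp add: T_def Int_def)
  qed
  have "\<exists>e>0. \<forall>x\<in>T. e \<le> f x"
  proof (cases "T = {}")
    case True
    then show ?thesis by (auto intro: exI[of _ 1])
  next
    case False
    have "continuous_on T f" by (rule continuous_on_subset[OF cont]) (auto simp: T_def)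
    then obtain x1 where x1: "x1 \<in> T" "\<And>x. x \<in> T \<Longrightarrow> f x1 \<le> f x"
      using continuous_attains_inf[OF T False] by metis
    have "x1 \<noteq> xs" using x1(1) \<rho>0 mat_norm_scaleR[of H 0 0] by (auto simp: T_def)
    then have "0 < f x1" using x1(1) by (intro objective_pos) (auto simp: T_def)
    then show ?thesis using x1 by blast
  qed
  then obtain e where e: "0 < e" "\<And>x. x \<in> T \<Longrightarrow> e \<le> f x" by blast
  define R where "R = b * (2 * r)"
  have R: "0 < R" using ab r by (simp add: R_def)
  show thesis
  proof (rule that[of "min (1 / 2) (e / R\<^sup>2)"])
    fix x :: "real ^ 'n" assume x: "x \<in> cball 0 r"
    show "min (1 / 2) (e / R\<^sup>2) * (mat_norm H (x - xs))\<^sup>2 \<le> f x"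
    proof (cases "x \<in> T")
      case False
      have "min (1 / 2) (e / R\<^sup>2) * (mat_norm H (x - xs))\<^sup>2 \<le> 1 / 2 * (mat_norm H (x - xs))\<^sup>2"
        by (intro mult_right_mono min.cobounded1) simp
      then show ?thesis using near[OF x False] by linarith
    next
      case True
      have "mat_norm H (x - xs) \<le> b * norm (x - xs)" by (rule ab)
      also have "\<dots> \<le> R" using norm_diff_minimizer_le[OF x] ab by (simp add: R_def)
      finally have "(mat_norm H (x - xs))\<^sup>2 \<le> R\<^sup>2"
        using mat_norm_nonneg[OF H] by (intro power_mono) auto
      then have "min (1 / 2) (e / R\<^sup>2) * (mat_norm H (x - xs))\<^sup>2 \<le> e / R\<^sup>2 * R\<^sup>2"
        using e by (intro mult_mono) auto
      then show ?thesis using e(2)[OF True] R by simp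
    qed
  qed (use e R in auto)
qed

text \<open>By the quadratic upper bound the sublevel set contains a ball about the minimizer of
  radius proportional to sqrt c. Its probability is the d-th power of the ratio of the radii, d
  being the dimension.\<close>

lemma sublevel_volume:
  assumes B: "0 < B"
  obtains \<kappa> where "0 < \<kappa>" "\<And>c. 0 < c \<Longrightarrow> c \<le> B \<Longrightarrow>
    \<kappa> * c powr (real CARD('n) / 2) \<le> measure (unif (cball 0 r)) {x \<in> cball 0 r. f x \<le> c}"
proof -
  interpret prob_space "unif (cball (0 :: real ^ 'n) r)" by (rule prob_space_unif_cball[OF r])
  obtain K where K: "0 < K" "\<And>x. x \<in> cball 0 r \<Longrightarrow> f x \<le> K * (norm (x - xs))\<^sup>2"
    by (metis objective_upper)
  \<comment> \<open>For \<open>c \<le> B\<close> the second entry keeps the ball of radius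
    \<open>s * sqrt (c / K)\<close> about \<open>xs\<close> inside \<open>cball 0 r\<close>; the
    first gives K \<rho>^2 \<le> c.\<close>
  define s where "s = min 1 ((r - norm xs) / sqrt (B / K))"
  have s: "0 < s" "s \<le> 1" using xs B K by (auto simp: s_def)
  show thesis
  proof (rule that[of "(s / (sqrt K * r)) ^ CARD('n)"])
    show "0 < (s / (sqrt K * r)) ^ CARD('n)" using s K r by simp
    fix c assume c: "0 < c" "c \<le> B"
    define \<rho> where "\<rho> = s * sqrt (c / K)"
    have \<rho>: "0 < \<rho>" using s c K by (simp add: \<rho>_def)
    have "\<rho> \<le> (r - norm xs) / sqrt (B / K) * sqrt (B / K)"
      unfolding \<rho>_def using c K xs s by (intro mult_mono) (auto simp: s_def divide_right_mono)
    then have \<rho>r: "\<rho> \<le> r - norm xs" using B K by simp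
    have "\<rho> \<le> 1 * sqrt (c / K)" unfolding \<rho>_def using s c K by (intro mult_right_mono) auto
    then have "\<rho>\<^sup>2 \<le> (sqrt (c / K))\<^sup>2" using \<rho> by (intro power_mono) auto
    then have \<rho>2: "K * \<rho>\<^sup>2 \<le> c" using c K by (simp add: field_simps)
    have sub: "cball xs \<rho> \<subseteq> cball 0 r"
      using \<rho>r by (auto simp: cball_subset_cball_iff)
    have sub2: "cball xs \<rho> \<subseteq> {x \<in> cball 0 r. f x \<le> c}"
    proof
      fix x assume x: "x \<in> cball xs \<rho>"
      then have "(norm (x - xs))\<^sup>2 \<le> \<rho>\<^sup>2" by (intro power_mono) (auto simp: dist_norm norm_minus_commute)
      then have "K * (norm (x - xs))\<^sup>2 \<le> K * \<rho>\<^sup>2" using K by simp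
      then show "x \<in> {x \<in> cball 0 r. f x \<le> c}" using x sub K(2)[of x] \<rho>2 by auto
    qed
    have meas: "{x \<in> cball 0 r. f x \<le> c} \<in> sets (unif (cball 0 r))"
    proof -
      have "f \<in> borel_measurable (unif (cball 0 r))"
        using borel_measurable_continuous_on_restrict[OF cont] by (simp only: measurable_cong_sets[OF sets_unif refl])
      then have "{x \<in> space (unif (cball 0 r)). f x \<le> c} \<in> sets (unif (cball 0 r))" by measurable
      then show ?thesis by (simp only: space_unif)
    qed
    have "(s / (sqrt K * r)) ^ CARD('n) * c powr (real CARD('n) / 2) = (\<rho> / r) ^ CARD('n)"
    proof -
      have "c powr (real CARD('n) / 2) = (c powr (1 / 2)) powr (real CARD('n))"
        by (simp add: powr_powr)
      also have "\<dots> = sqrt c ^ CARD('n)" using c by (simp add: powr_half_sqrt powr_realpow)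
      finally show ?thesis using c K by (simp add: \<rho>_def real_sqrt_divide power_mult_distrib power_divide)
    qed
    also have "\<dots> = measure (unif (cball 0 r)) (cball xs \<rho>)"
    proof -
      have "unit_ball_vol (real CARD('n)) \<noteq> 0"
        using unit_ball_vol_pos[of "real CARD('n)"] by (metis less_irrefl of_nat_0_le_iff)
      then show ?thesis
        using \<rho> r sub by (subst measure_unif_cball) (simp_all add: content_cball power_divide)
    qed
    also have "\<dots> \<le> measure (unif (cball 0 r)) {x \<in> cball 0 r. f x \<le> c}"
      using sub2 meas by (intro finite_measure_mono)
    finally show "(s / (sqrt K * r)) ^ CARD('n) * c powr (real CARD('n) / 2)
        \<le> measure (unif (cball 0 r)) {x \<in> cball 0 r. f x \<le> c}" .
  qed
qed

text \<open>The inner ellipsoid contributes nothing by symmetry, so only the shell between the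
  ellipsoids matters. Its share of the outer one is 1 - t^d, at most d (1 - t) by Bernoulli. As t
  \<ge> 1/2, the outer ellipsoid has at most 2^d times the measure of the inner one, hence of
  \<open>A\<close>.\<close>

lemma sandwiched_center:
  fixes A :: "(real ^ 'n) set"
  assumes A: "A \<in> sets borel" and t: "1 / 2 \<le> t" "t \<le> 1"
    and sub: "ellipsoid H xs (t * \<rho>) \<subseteq> A" "A \<subseteq> ellipsoid H xs \<rho>" "ellipsoid H xs \<rho> \<subseteq> cball 0 r"
    and D: "\<And>y. y \<in> A \<Longrightarrow> norm (y - xs) \<le> D" "0 \<le> D"
  shows "\<bar>\<integral>y. indicator A y * (y - xs) $ c \<partial>unif (cball 0 r)\<bar>
    \<le> D * (real CARD('n) * (1 - t) * 2 ^ CARD('n)) * measure (unif (cball 0 r)) A"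
proof -
  let ?U = "unif (cball (0 :: real ^ 'n) r)" and ?d = "CARD('n)"
  interpret prob_space ?U by (rule prob_space_unif_cball[OF r])
  let ?E = "ellipsoid H xs (t * \<rho>)" and ?E' = "ellipsoid H xs \<rho>"
  have borelE: "ellipsoid H xs s \<in> sets borel" for s by (rule borel_closed[OF closed_ellipsoid])
  have sets: "A \<in> events" "?E \<in> events" "?E' \<in> events"
    unfolding sets_unif_cball_iff using sub A borelE by auto
  have probE: "prob ?E = t ^ ?d * prob ?E'"
    using measure_unif_cball[OF borelE _ r, of "t * \<rho>"] measure_unif_cball[OF borelE _ r, of \<rho>]
      subset_trans[OF sub(1) subset_trans[OF sub(2,3)]] sub(3) measure_lborel_ellipsoid_scale[of t H xs \<rho>] t
    by simp
  have coord: "(\<lambda>y. (y - xs) $ c) \<in> borel_measurable borel"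
    by (intro borel_measurable_continuous_onI continuous_intros)
  have coordU: "(\<lambda>y. (y - xs) $ c) \<in> borel_measurable ?U"
    using measurable_restrict_space1[OF coord, of "cball 0 r"]
    by (simp only: measurable_cong_sets[OF sets_unif refl])
  have bound: "\<bar>(y - xs) $ c\<bar> \<le> D" if "y \<in> A" for y
    using component_le_norm_cart[of "y - xs" c] D(1)[OF that] by linarith
  have int: "integrable ?U (\<lambda>y. indicator T y * (y - xs) $ c)" if "T \<in> events" "T \<subseteq> A" for T
    using that bound D(2) coordU
    by (intro integrable_bounded[where B = D] borel_measurable_times borel_measurable_indicator)
       (auto simp: indicator_def)
  have zero: "(\<integral>y. indicator ?E y * (y - xs) $ c \<partial>?U) = 0"
  proof -
    have "(\<integral>y. indicator ?E y * (y - xs) $ c \<partial>?U) =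
      (\<integral>y. indicator (cball 0 r) y * (indicator ?E y * (y - xs) $ c) \<partial>lborel) / measure lborel (cball (0 :: real ^ 'n) r)"
      using coord borelE by (intro integral_unif_cball borel_measurable_times borel_measurable_indicator r) auto
    also have "(\<lambda>y. indicator (cball 0 r) y * (indicator ?E y * (y - xs) $ c)) = (\<lambda>y. indicator ?E y * (y - xs) $ c)"
      using subset_trans[OF sub(1) subset_trans[OF sub(2,3)]] by (auto simp: indicator_def fun_eq_iff)
    finally show ?thesis by (simp only: integral_ellipsoid_centered div_0)
  qed
  have "(\<integral>y. indicator A y * (y - xs) $ c \<partial>?U)
      = (\<integral>y. indicator (A - ?E) y * (y - xs) $ c + indicator ?E y * (y - xs) $ c \<partial>?U)"
    using sub by (intro Bochner_Integration.integral_cong) (auto simp: indicator_def)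
  also have "\<dots> = (\<integral>y. indicator (A - ?E) y * (y - xs) $ c \<partial>?U)"
    using int[of "A - ?E"] int[of ?E] sets sub zero by simp
  finally have "\<bar>\<integral>y. indicator A y * (y - xs) $ c \<partial>?U\<bar> \<le> (\<integral>y. \<bar>indicator (A - ?E) y * (y - xs) $ c\<bar> \<partial>?U)"
    by (simp only: integral_abs_bound)
  also have "\<dots> \<le> (\<integral>y. D * indicator (A - ?E) y \<partial>?U)"
  proof (rule integral_mono)
    show "integrable ?U (\<lambda>y. \<bar>indicator (A - ?E) y * (y - xs) $ c\<bar>)"
      using int[of "A - ?E"] sets by (intro integrable_abs) auto
    show "integrable ?U (\<lambda>y. D * indicator (A - ?E) y)"
      using sets by (intro integrable_mult_right integrable_bounded[where B = 1]) (auto simp: indicator_def)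
  qed (use bound in \<open>auto simp: indicator_def\<close>)
  also have "\<dots> = D * prob (A - ?E)"
  proof -
    have "(A - ?E) \<inter> space ?U = A - ?E" using sets.sets_into_space[OF sets(1)] by blast
    then show ?thesis by simp
  qed
  also have "\<dots> \<le> D * prob (?E' - ?E)"
    using sets sub D by (intro mult_left_mono finite_measure_mono) auto
  also have "prob (?E' - ?E) = (1 - t ^ ?d) * prob ?E'"
  proof -
    show ?thesis
      using sets sub probE by (subst finite_measure_Diff) (auto simp: algebra_simps)
  qed
  also have "D * ((1 - t ^ ?d) * prob ?E') \<le> D * ((real ?d * (1 - t)) * (2 ^ ?d * prob A))"
  proof (intro mult_left_mono[OF _ D(2)] mult_mono)
    show "1 - t ^ ?d \<le> real ?d * (1 - t)"
      using Bernoulli_inequality[of "t - 1" ?d] t by (simp add: algebra_simps)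
    have "(1 / 2) ^ ?d \<le> t ^ ?d" using t by (intro power_mono) auto
    then have "(1 / 2) ^ ?d * prob ?E' \<le> prob ?E"
      unfolding probE by (intro mult_right_mono) auto
    also have "\<dots> \<le> prob A" using sets sub by (intro finite_measure_mono)
    finally show "prob ?E' \<le> 2 ^ ?d * prob A" by (simp add: field_simps)
  qed (use t in auto)
  finally show ?thesis by (simp add: mult_ac)
qed

text \<open>\<open>A\<close> may be any Borel set between the strict and the weak sublevel set,
  which covers both tie rules. For \<open>h\<close> away from 0 the bound 2 r on distances suffices.
  For small \<open>h\<close> apply \<open>sandwiched_center\<close>: points of \<open>A\<close> are
  at distance of order sqrt h, and 1 - t is of order h^((\<alpha>-2)/2).\<close>

lemma sublevel_center:
  obtains C where "0 < C" "\<And>h A c. 0 \<le> h \<Longrightarrow> A \<in> sets borel \<Longrightarrow>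
    {y \<in> cball 0 r. f y < h} \<subseteq> A \<Longrightarrow> A \<subseteq> {y \<in> cball 0 r. f y \<le> h} \<Longrightarrow>
    \<bar>\<integral>y. indicator A y * (y - xs) $ c \<partial>unif (cball 0 r)\<bar>
      \<le> C * h powr ((\<alpha> - 1) / 2) * measure (unif (cball 0 r)) A"
proof -
  let ?U = "unif (cball (0 :: real ^ 'n) r)" and ?d = "CARD('n)"
  interpret prob_space ?U by (rule prob_space_unif_cball[OF r])
  obtain \<rho>0 where \<rho>0: "0 < \<rho>0" "M * \<rho>0 powr (\<alpha> - 2) \<le> 1 / 2" by (rule exists_small_radius)
  obtain a b where ab: "0 < a" "0 < b"
    "\<And>y. a * norm y \<le> mat_norm H y" "\<And>y. mat_norm H y \<le> b * norm y"
    using mat_norm_equiv_norm[OF H] by metis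
  obtain k where k: "0 < k" "k \<le> 1" "\<And>x. x \<in> cball 0 r \<Longrightarrow> k * (mat_norm H (x - xs))\<^sup>2 \<le> f x"
    by (metis objective_lower)
  \<comment> \<open>By \<open>objective_lower\<close>, points of \<open>A\<close> have H-distance at
    most w sqrt h from the minimizer. This a priori radius is the range on which the error bound has
    to be controlled.\<close>
  define w where "w = 1 / sqrt k"
  have w: "1 \<le> w" using k by (simp add: w_def)
  \<comment> \<open>For \<open>u \<le> u0\<close> the first entry gives w u \<le> \<rho>0, so the
    relative error \<open>\<tau>\<close> is at most 1/2; the second keeps the outer ellipsoid, of
    radius at most 2 u, inside the ball.\<close>
  define u0 where "u0 = min (\<rho>0 / w) (a * (r - norm xs) / 2)"
  have u0: "0 < u0" using \<rho>0 w ab xs by (simp add: u0_def)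
  define C1 where "C1 = 2 * r / u0 powr (\<alpha> - 1)"
  define C2 where "C2 = (w / a) * (real ?d * (M * w powr (\<alpha> - 2)) * 2 ^ ?d)"
  have C1: "0 < C1" using r u0 by (simp add: C1_def)
  have C2: "0 < C2" using w ab M by (simp add: C2_def)
  show thesis
  proof (rule that[of "max C1 C2"])
    show "0 < max C1 C2" using C1 by simp
    fix h A c
    assume h: "0 \<le> h" and A: "A \<in> sets borel"
      and sub: "{y \<in> cball 0 r. f y < h} \<subseteq> A" "A \<subseteq> {y \<in> cball 0 r. f y \<le> h}"
    define u where "u = sqrt h"
    have u: "0 \<le> u" "u\<^sup>2 = h" using h by (auto simp: u_def)
    have hpow: "h powr ((\<alpha> - 1) / 2) = u powr (\<alpha> - 1)"
    proof (cases "h = 0")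
      case False
      then have "u = h powr (1 / 2)" using h by (simp add: u_def powr_half_sqrt)
      then show ?thesis by (simp add: powr_powr)
    qed (simp add: u_def)
    have Aball: "A \<subseteq> cball 0 r" using sub by auto
    have Asets: "A \<in> events" unfolding sets_unif_cball_iff using Aball A by simp
    have N_le: "mat_norm H (y - xs) \<le> w * u" if "y \<in> A" for y
    proof -
      have "k * (mat_norm H (y - xs))\<^sup>2 \<le> u\<^sup>2"
        using k(3)[of y] that sub(2) u by force
      then have "(mat_norm H (y - xs))\<^sup>2 \<le> (w * u)\<^sup>2"
        using k by (simp add: w_def power_divide field_simps)
      then show ?thesis by (rule power2_le_imp_le) (use w u in auto)
    qed
    have norm_le: "norm (y - xs) \<le> w * u / a" if "y \<in> A" for y
      using N_le[OF that] ab(3)[of "y - xs"] ab(1) by (simp add: field_simps)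
    have le_max: "\<bar>\<integral>y. indicator A y * (y - xs) $ c \<partial>?U\<bar> \<le> max C1 C2 * h powr ((\<alpha> - 1) / 2) * prob A"
      if "\<bar>\<integral>y. indicator A y * (y - xs) $ c \<partial>?U\<bar> \<le> C' * u powr (\<alpha> - 1) * prob A" "C' \<le> max C1 C2" for C'
      using that(1) order_trans[OF that(1) mult_right_mono[OF mult_right_mono[OF that(2)]]] by (simp add: hpow)
    show "\<bar>\<integral>y. indicator A y * (y - xs) $ c \<partial>?U\<bar> \<le> max C1 C2 * h powr ((\<alpha> - 1) / 2) * prob A"
    proof (cases "u \<le> u0")
      case False
      have "\<bar>\<integral>y. indicator A y * (y - xs) $ c \<partial>?U\<bar> \<le> (\<integral>y. \<bar>indicator A y * (y - xs) $ c\<bar> \<partial>?U)"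
        by (rule integral_abs_bound)
      also have "\<dots> \<le> (\<integral>y. 2 * r * indicator A y \<partial>?U)"
      proof (rule integral_mono')
        show "integrable ?U (\<lambda>y. 2 * r * indicator A y)"
          using Asets by (intro integrable_mult_right integrable_bounded[where B = 1]) (auto simp: indicator_def)
        show "\<bar>indicator A y * (y - xs) $ c\<bar> \<le> 2 * r * indicator A y" if "y \<in> space ?U" for y
          using component_le_norm_cart[of "y - xs" c] norm_diff_minimizer_le[of y] Aball by (auto simp: indicator_def)
      qed (use r in \<open>auto simp: indicator_def\<close>)
      also have "\<dots> = 2 * r * prob A"
        using sets.sets_into_space[OF Asets] by (simp add: Int_absorb2)
      also have "\<dots> \<le> C1 * u powr (\<alpha> - 1) * prob A"
      proof (rule mult_right_mono)
        have "u0 powr (\<alpha> - 1) \<le> u powr (\<alpha> - 1)" using False u0 \<alpha> by (intro powr_mono2) auto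
        then have "2 * r * 1 \<le> 2 * r * (u powr (\<alpha> - 1) / u0 powr (\<alpha> - 1))"
          using r u0 by (intro mult_left_mono) auto
        then show "2 * r \<le> C1 * u powr (\<alpha> - 1)" by (simp add: C1_def)
      qed simp
      finally show ?thesis by (rule le_max) simp
    next
      case True
      show ?thesis
      proof (cases "u = 0")
        case True
        \<comment> \<open>Here \<open>norm_le\<close> leaves at most the minimizer in
          \<open>A\<close>, where the integrand is 0.\<close>
        have "(\<integral>y. indicator A y * (y - xs) $ c \<partial>?U) = (\<integral>y. 0 \<partial>?U)"
          using norm_le True by (intro Bochner_Integration.integral_cong) (auto simp: indicator_def)
        then show ?thesis using C1 by simp
      next
        case False
        then have u_pos: "0 < u" using u by simp
        define \<tau> where "\<tau> = M * (w * u) powr (\<alpha> - 2)"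
        have \<tau>0: "0 < \<tau>" using M w u_pos by (simp add: \<tau>_def)
        have "w * u \<le> w * (\<rho>0 / w)" using True w by (intro mult_left_mono) (auto simp: u0_def)
        then have "(w * u) powr (\<alpha> - 2) \<le> \<rho>0 powr (\<alpha> - 2)"
          using w u \<alpha> by (intro powr_mono2) auto
        then have "\<tau> \<le> M * \<rho>0 powr (\<alpha> - 2)" unfolding \<tau>_def using M by (intro mult_left_mono) auto
        then have \<tau>1: "\<tau> \<le> 1 / 2" using \<rho>0(2) by simp
        define t where "t = 1 - \<tau>"
        have t: "1 / 2 \<le> t" "t < 1" "0 < t" using \<tau>0 \<tau>1 by (auto simp: t_def)
        \<comment> \<open>The outer radius solves t \<rho>^2 = h: on \<open>A\<close> the expansion
          gives t N^2 \<le> f y \<le> h for the H-distance N.\<close>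
        define \<rho> where "\<rho> = u / sqrt t"
        have \<rho>: "0 < \<rho>" using u_pos t by (simp add: \<rho>_def)
        have \<rho>2: "\<rho>\<^sup>2 = h / t" using t u by (simp add: \<rho>_def power_divide)
        have "1 / 4 \<le> t" using t by simp
        then have "sqrt (1 / 4) \<le> sqrt t" by (simp only: real_sqrt_le_iff)
        then have "1 / 2 \<le> sqrt t" by (simp add: real_sqrt_divide)
        then have \<rho>u: "\<rho> \<le> 2 * u" using u_pos t by (simp add: \<rho>_def field_simps)
        have err: "\<bar>f y - (mat_norm H (y - xs))\<^sup>2\<bar> \<le> \<tau> * (mat_norm H (y - xs))\<^sup>2"
          if "y \<in> cball 0 r" "mat_norm H (y - xs) \<le> w * u" for y
          using objective_quadratic_error[OF that] by (simp add: \<tau>_def)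
        have E_ball: "ellipsoid H xs \<rho> \<subseteq> cball 0 r"
        proof
          fix y assume "y \<in> ellipsoid H xs \<rho>"
          then have "a * norm (y - xs) \<le> 2 * u"
            using ab(3)[of "y - xs"] \<rho>u by (simp add: ellipsoid_def)
          also have "\<dots> \<le> a * (r - norm xs)" using True by (simp add: u0_def)
          finally have "norm (y - xs) \<le> r - norm xs" using ab by simp
          then show "y \<in> cball 0 r" using norm_triangle_sub[of y xs] by simp
        qed
        have A_E: "A \<subseteq> ellipsoid H xs \<rho>"
        proof
          fix y assume y: "y \<in> A"
          have "t * (mat_norm H (y - xs))\<^sup>2 \<le> f y"
            using err[OF _ N_le[OF y]] Aball y by (auto simp: t_def algebra_simps)
          also have "\<dots> \<le> h" using sub y by auto
          finally have "(mat_norm H (y - xs))\<^sup>2 \<le> \<rho>\<^sup>2" unfolding \<rho>2 using t by (simp add: field_simps)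
          then show "y \<in> ellipsoid H xs \<rho>"
            using \<rho> power2_le_imp_le[of "mat_norm H (y - xs)" \<rho>] by (simp add: ellipsoid_def)
        qed
        have E_A: "ellipsoid H xs (t * \<rho>) \<subseteq> A"
        proof
          fix y assume "y \<in> ellipsoid H xs (t * \<rho>)"
          then have N: "mat_norm H (y - xs) \<le> t * \<rho>" by (simp add: ellipsoid_def)
          have "t * \<rho> \<le> 1 * \<rho>" using t \<rho> by (intro mult_right_mono) auto
          then have "y \<in> ellipsoid H xs \<rho>" using N by (simp add: ellipsoid_def)
          then have y: "y \<in> cball 0 r" using E_ball by blast
          have N2: "(mat_norm H (y - xs))\<^sup>2 \<le> t * h"
          proof -
            have "(mat_norm H (y - xs))\<^sup>2 \<le> (t * \<rho>)\<^sup>2"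
              using N mat_norm_nonneg[OF H] by (intro power_mono) auto
            also have "\<dots> = t * h" unfolding power_mult_distrib \<rho>2 using t by (simp add: power2_eq_square)
            finally show ?thesis .
          qed
          also have "\<dots> \<le> 1 * h" using t h by (intro mult_right_mono) auto
          finally have "mat_norm H (y - xs) \<le> u" using power2_le_imp_le[of "mat_norm H (y - xs)" u] u by simp
          also have "\<dots> \<le> w * u" using mult_right_mono[OF w u(1)] by simp
          finally have "f y \<le> (1 + \<tau>) * (mat_norm H (y - xs))\<^sup>2"
            using err[OF y] by (auto simp: algebra_simps)
          also have "\<dots> \<le> (1 + \<tau>) * (t * h)" using N2 \<tau>0 by (intro mult_left_mono) auto
          \<comment> \<open>The inner radius is chosen so that its square is t h; the factor 1 -
            \<tau>^2 is strictly below 1, so the inner ellipsoid lies even in the strict sublevel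
            set.\<close>
          also have "\<dots> = (1 - \<tau>\<^sup>2) * h" by (simp add: t_def algebra_simps power2_eq_square)
          also have "\<dots> < 1 * h" using \<tau>0 u_pos u by (intro mult_strict_right_mono) auto
          finally show "y \<in> A" using sub y by auto
        qed
        have "\<bar>\<integral>y. indicator A y * (y - xs) $ c \<partial>?U\<bar>
            \<le> (w * u / a) * (real ?d * (1 - t) * 2 ^ ?d) * prob A"
          using t w u ab by (intro sandwiched_center[OF A _ _ E_A A_E E_ball norm_le]) auto
        also have "(w * u / a) * (real ?d * (1 - t) * 2 ^ ?d) = C2 * u powr (\<alpha> - 1)"
        proof -
          have "u powr (\<alpha> - 1) = u * u powr (\<alpha> - 2)"
            using u_pos powr_add[of u 1 "\<alpha> - 2"] by simp
          moreover have "1 - t = M * w powr (\<alpha> - 2) * u powr (\<alpha> - 2)"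
            using w u by (simp add: t_def \<tau>_def powr_mult)
          ultimately show ?thesis by (simp add: C2_def)
        qed
        finally show ?thesis by (rule le_max) simp
      qed
    qed
  qed
qed

end

section \<open>The expected objective value\<close>

text \<open>The quadratic upper bound reduces the claim to the mean square of each coordinate of the
  displacement from \<open>xs\<close>. There \<open>second_moment_mean_selected_le\<close> applies
  with \<open>D\<close> taken from \<open>sublevel_center\<close>. Since the square of
  \<open>D\<close> is a multiple of f^(\<alpha>-1), threshold moments enter for q = \<alpha>-1 and q
  = 1.\<close>

lemma expected_value_le:
  fixes f :: "real ^ 'n \<Rightarrow> real"
  assumes r: "0 < r" and fA: "assumption_A r \<alpha> f"
  obtains C C' where "0 < C" "0 < C'" "\<And>l m. 1 \<le> m \<Longrightarrow> m < l \<Longrightarrow> expected_value r f l m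
     \<le> C * (real m powr (2 * (\<alpha> - 1) / real CARD('n)) / real l powr (2 * (\<alpha> - 1) / real CARD('n)))
      + C' * (real m powr (2 / real CARD('n) - 1) / real l powr (2 / real CARD('n)))"
proof -
  let ?d = "real CARD('n)" and ?S = "cball (0 :: real ^ 'n) r" and ?U = "unif (cball (0 :: real ^ 'n) r)"
  obtain xs H \<epsilon> M where cont: "continuous_on ?S f" and \<alpha>: "2 < \<alpha>"
    and A: "\<And>x. is_arg_min f (\<lambda>y. y \<in> ?S) x \<longleftrightarrow> x = xs" "norm xs < r" "f xs = 0"
      "pos_def_matrix H" "0 < M" "\<And>y. \<bar>\<epsilon> y\<bar> \<le> M"
      "\<And>x. x \<in> ?S \<Longrightarrow> f x = mat_norm H (x - xs) ^ 2 + mat_norm H (x - xs) powr \<alpha> * \<epsilon> (x - xs)"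
    using fA unfolding assumption_A_def by blast
  note ctx = r cont \<alpha> A
  have d: "0 < ?d" by simp
  obtain K where K: "0 < K" "\<And>x. x \<in> ?S \<Longrightarrow> f x \<le> K * (norm (x - xs))\<^sup>2"
    using objective_upper[OF ctx] by metis
  obtain a b where ab: "0 < a" "\<And>y. a * norm y \<le> mat_norm H y"
    using mat_norm_equiv_norm[OF A(4)] by metis
  obtain k where k: "0 < k" "\<And>x. x \<in> ?S \<Longrightarrow> k * (mat_norm H (x - xs))\<^sup>2 \<le> f x"
    using objective_lower[OF ctx] by metis
  define C0 where "C0 = 1 / (k * a\<^sup>2)"
  have C0: "0 < C0" using k ab by (simp add: C0_def)
  have norm_le: "(norm (x - xs))\<^sup>2 \<le> C0 * f x" if "x \<in> ?S" for x
  proof -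
    have "(a * norm (x - xs))\<^sup>2 \<le> (mat_norm H (x - xs))\<^sup>2" using ab by (intro power_mono) auto
    then have "k * (a * norm (x - xs))\<^sup>2 \<le> f x" using k(2)[OF that] k(1) by (meson mult_le_cancel_left_pos order_trans)
    then show ?thesis using k ab by (simp add: C0_def field_simps power_mult_distrib)
  qed
  define B where "B = K * (2 * r)\<^sup>2"
  have B: "0 < B" using K r by (simp add: B_def)
  have norm_diff_le: "norm (x - xs) \<le> 2 * r" if "x \<in> ?S" for x
    using norm_diff_minimizer_le[OF ctx, OF _ that] by blast
  have fB: "f x \<le> B" if "x \<in> ?S" for x
  proof -
    have "K * (norm (x - xs))\<^sup>2 \<le> B"
      unfolding B_def using norm_diff_le[OF that] K by (intro mult_left_mono power_mono) auto
    then show ?thesis using K(2)[OF that] by linarith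
  qed
  have f0: "0 \<le> f x" if "x \<in> ?S" for x
    using objective_nonneg[OF ctx, OF _ that] by blast
  obtain \<kappa> where \<kappa>: "0 < \<kappa>" "\<And>c. 0 < c \<Longrightarrow> c \<le> B \<Longrightarrow>
      \<kappa> * c powr (?d / 2) \<le> measure ?U {x \<in> ?S. f x \<le> c}"
    by (rule sublevel_volume[OF ctx B, rotated]) blast+
  obtain Cc where Cc: "0 < Cc" "\<And>h A c. 0 \<le> h \<Longrightarrow> A \<in> sets borel \<Longrightarrow>
    {y \<in> ?S. f y < h} \<subseteq> A \<Longrightarrow> A \<subseteq> {y \<in> ?S. f y \<le> h} \<Longrightarrow>
    \<bar>\<integral>y. indicator A y * (y - xs) $ c \<partial>?U\<bar> \<le> Cc * h powr ((\<alpha> - 1) / 2) * measure ?U A"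
    by (rule sublevel_center[OF ctx, rotated]) blast+
  define D where "D y = Cc * f y powr ((\<alpha> - 1) / 2)" for y
  define \<Gamma> where "\<Gamma> q = (\<Sum>s. (4 * (real s + 1)) powr (q / (?d / 2)) * exp (- real s)) / \<kappa> powr (q / (?d / 2))" for q
  \<comment> \<open>One bound for \<open>f\<close>, for the coordinates and for \<open>D\<close>,
    since the second moment estimate asks for a common one.\<close>
  define B' where "B' = B + 2 * r + Cc * B powr ((\<alpha> - 1) / 2)"
  have fU: "f \<in> borel_measurable ?U"
    using borel_measurable_continuous_on_restrict[OF cont] by (simp only: measurable_cong_sets[OF sets_unif refl])
  have gU: "(\<lambda>y. (y - xs) $ c) \<in> borel_measurable ?U" for c
  proof -
    have "(\<lambda>y. (y - xs) $ c) \<in> borel_measurable borel"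
      by (intro borel_measurable_continuous_onI continuous_intros)
    from measurable_restrict_space1[OF this, of ?S] show ?thesis
      by (simp only: measurable_cong_sets[OF sets_unif refl])
  qed
  have DU: "D \<in> borel_measurable ?U" unfolding D_def[abs_def] using fU by measurable
  have sub_borel: "{y \<in> ?S. f y < h} \<in> sets borel" "{y \<in> ?S. f y \<le> h} \<in> sets borel" for h
  proof -
    have "{y \<in> space ?U. f y < h} \<in> sets ?U" "{y \<in> space ?U. f y \<le> h} \<in> sets ?U"
      using fU by measurable
    then show "{y \<in> ?S. f y < h} \<in> sets borel" "{y \<in> ?S. f y \<le> h} \<in> sets borel"
      by (simp_all only: space_unif sets_unif_cball_iff)
  qed
  have key: "expected_value r f l m
      \<le> K * ?d * Cc\<^sup>2 * \<Gamma> (\<alpha> - 1) * (real m powr (2 * (\<alpha> - 1) / ?d) / real l powr (2 * (\<alpha> - 1) / ?d))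
        + K * ?d * C0 * \<Gamma> 1 * (real m powr (2 / ?d - 1) / real l powr (2 / ?d))"
    if m: "1 \<le> m" "m < l" for l m
  proof -
    let ?P = "sample_law r l :: (nat \<Rightarrow> real ^ 'n) measure"
    interpret P: prob_space ?P by (rule prob_space_sample_law[OF r])
    have P: "?P = PiM {1..l} (\<lambda>_. ?U)" by (simp add: sample_law_def)
    define h where "h X = f (X (sort_key (\<lambda>j. f (X j)) [1..<Suc l] ! m))" for X
    \<comment> \<open>\<open>ordered_point\<close> counts from 1, list positions from 0.\<close>
    have h_eq: "h X = f (ordered_point f l X (Suc m))" for X
      by (simp add: h_def ordered_point_def del: upt_Suc)
    have op: "(\<lambda>X. ordered_point f l X (Suc m)) \<in> measurable ?P (restrict_space borel ?S)"
      using measurable_ordered_point[OF cont, of "Suc m" l] ordered_point_in_cball[of _ r l "Suc m" f] m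
      by (intro measurable_restrict_space2) auto
    have hm: "h \<in> borel_measurable ?P"
      unfolding h_eq[abs_def] by (rule measurable_compose[OF op borel_measurable_continuous_on_restrict[OF cont]])
    have h_range: "0 \<le> h X" "h X \<le> B" if "X \<in> space ?P" for X
      using ordered_point_in_cball[OF that, of "Suc m" f] f0 fB m unfolding h_eq by auto
    have moment: "P.expectation (\<lambda>X. h X powr q) \<le> \<Gamma> q * (real m / real l) powr (2 * q / ?d)" if "0 < q" for q
      using moment_threshold_le[OF prob_space_unif_cball[OF r] fU m(2), of "?d / 2" \<kappa> q B]
        that \<kappa> d f0 fB m hm
      unfolding space_unif P h_def \<Gamma>_def by (simp add: mult.commute[of q 2])
    \<comment> \<open>The first moment is written with \<open>powr 1\<close> so that
      \<open>moment\<close> serves both terms; this is \<open>h X\<close> because \<open>h\<close>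
      is nonnegative.\<close>
    have second: "P.expectation (\<lambda>X. ((best_mean f l m X - xs) $ c)\<^sup>2)
        \<le> Cc\<^sup>2 * P.expectation (\<lambda>X. h X powr (\<alpha> - 1)) + C0 / real m * P.expectation (\<lambda>X. h X powr 1)" for c
    proof -
      have mean: "(best_mean f l m X - xs) $ c =
          (1 / real m) * (\<Sum>i=1..m. (X (sort_key (\<lambda>j. f (X j)) [1..<Suc l] ! (i - 1)) - xs) $ c)" for X
        using m by (simp add: best_mean_def ordered_point_def sum_subtractf right_diff_distrib del: upt_Suc)
      have "P.expectation (\<lambda>X. ((best_mean f l m X - xs) $ c)\<^sup>2)
          \<le> P.expectation (\<lambda>X. (D (X (sort_key (\<lambda>j. f (X j)) [1..<Suc l] ! m)))\<^sup>2
             + C0 / real m * f (X (sort_key (\<lambda>j. f (X j)) [1..<Suc l] ! m)))"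
        unfolding mean P
      proof (rule second_moment_mean_selected_le[OF prob_space_unif_cball[OF r] fU gU DU m, where B = B'];
             (unfold space_unif)?)
        have pos: "0 \<le> Cc * B powr ((\<alpha> - 1) / 2)" using Cc by simp
        show "\<bar>f x\<bar> \<le> B'" if "x \<in> ?S" for x
          using f0[OF that] fB[OF that] pos r by (simp add: B'_def)
        show "\<bar>(x - xs) $ c\<bar> \<le> B'" if "x \<in> ?S" for x
          using component_le_norm_cart[of "x - xs" c] norm_diff_le[OF that] pos B by (simp add: B'_def)
        show "0 \<le> D x" for x using Cc by (simp add: D_def)
        show "D x \<le> B'" if "x \<in> ?S" for x
        proof -
          have "D x \<le> Cc * B powr ((\<alpha> - 1) / 2)"
            unfolding D_def using Cc f0[OF that] fB[OF that] \<alpha> by (intro mult_left_mono powr_mono2) auto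
          then show ?thesis using B r by (simp add: B'_def)
        qed
        show "0 \<le> C0" using C0 by simp
        show "((x - xs) $ c)\<^sup>2 \<le> C0 * f x" if "x \<in> ?S" for x
        proof -
          have "\<bar>(x - xs) $ c\<bar>\<^sup>2 \<le> (norm (x - xs))\<^sup>2"
            using component_le_norm_cart[of "x - xs" c] by (intro power_mono) auto
          then show ?thesis using norm_le[OF that] by simp
        qed
        show "\<bar>\<integral>y. indicator {y \<in> ?S. f y < f x} y * (y - xs) $ c \<partial>?U\<bar> \<le> D x * measure ?U {y \<in> ?S. f y < f x}"
          if "x \<in> ?S" for x
          unfolding D_def using f0[OF that] sub_borel by (intro Cc(2)) auto
        show "\<bar>\<integral>y. indicator {y \<in> ?S. f y \<le> f x} y * (y - xs) $ c \<partial>?U\<bar> \<le> D x * measure ?U {y \<in> ?S. f y \<le> f x}"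
          if "x \<in> ?S" for x
          unfolding D_def using f0[OF that] sub_borel by (intro Cc(2)) auto
      qed
      also have "\<dots> = P.expectation (\<lambda>X. Cc\<^sup>2 * h X powr (\<alpha> - 1) + C0 / real m * h X powr 1)"
      proof (rule Bochner_Integration.integral_cong[OF refl])
        fix X assume X: "X \<in> space ?P"
        have "(h X powr ((\<alpha> - 1) / 2))\<^sup>2 = h X powr (\<alpha> - 1)"
          by (simp add: power2_eq_square powr_add[symmetric])
        then show "(D (X (sort_key (\<lambda>j. f (X j)) [1..<Suc l] ! m)))\<^sup>2
             + C0 / real m * f (X (sort_key (\<lambda>j. f (X j)) [1..<Suc l] ! m))
           = Cc\<^sup>2 * h X powr (\<alpha> - 1) + C0 / real m * h X powr 1"
          using h_range[OF X] by (simp add: D_def h_def power_mult_distrib del: upt_Suc)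
      qed
      also have "\<dots> = Cc\<^sup>2 * P.expectation (\<lambda>X. h X powr (\<alpha> - 1)) + C0 / real m * P.expectation (\<lambda>X. h X powr 1)"
      proof -
        have "integrable ?P (\<lambda>X. h X powr q)" if "0 < q" for q
        proof (rule P.integrable_bounded[where B = "B powr q"])
          show "(\<lambda>X. h X powr q) \<in> borel_measurable ?P" using hm by measurable
          show "\<bar>h X powr q\<bar> \<le> B powr q" if "X \<in> space ?P" for X
            using h_range[OF that] \<open>0 < q\<close> by (simp add: powr_mono2)
        qed
        from this[of "\<alpha> - 1"] this[of 1] show ?thesis
          using \<alpha> by (subst Bochner_Integration.integral_add) (auto simp del: powr_one_gt_zero_iff)
      qed
      finally show ?thesis .
    qed
    have bm: "best_mean f l m \<in> borel_measurable ?P"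
      unfolding best_mean_def using m
      by (intro borel_measurable_scaleR borel_measurable_sum measurable_ordered_point[OF cont]) auto
    have int_c: "integrable ?P (\<lambda>X. ((best_mean f l m X - xs) $ c)\<^sup>2)" for c
    proof (rule P.integrable_bounded[where B = "(2 * r)\<^sup>2"])
      have "(\<lambda>y. ((y - xs) $ c)\<^sup>2) \<in> borel_measurable borel"
        by (intro borel_measurable_continuous_onI continuous_intros)
      then show "(\<lambda>X. ((best_mean f l m X - xs) $ c)\<^sup>2) \<in> borel_measurable ?P"
        by (rule measurable_compose[OF bm])
      fix X assume "X \<in> space ?P"
      then have "norm (best_mean f l m X - xs) \<le> 2 * r"
        using m by (intro norm_diff_le best_mean_in_cball) auto
      then have "\<bar>(best_mean f l m X - xs) $ c\<bar> \<le> 2 * r"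
        using component_le_norm_cart[of "best_mean f l m X - xs" c] by linarith
      then show "\<bar>((best_mean f l m X - xs) $ c)\<^sup>2\<bar> \<le> (2 * r)\<^sup>2"
        using power_mono[of "\<bar>(best_mean f l m X - xs) $ c\<bar>" "2 * r" 2] by simp
    qed
    have "expected_value r f l m \<le> P.expectation (\<lambda>X. K * (\<Sum>c\<in>UNIV. ((best_mean f l m X - xs) $ c)\<^sup>2))"
      unfolding expected_value_def
    proof (rule integral_mono)
      show "integrable ?P (\<lambda>X. f (best_mean f l m X))"
        using m by (intro integrable_best_mean[OF r cont]) auto
      show "integrable ?P (\<lambda>X. K * (\<Sum>c\<in>UNIV. ((best_mean f l m X - xs) $ c)\<^sup>2))"
        using int_c by (intro integrable_mult_right Bochner_Integration.integrable_sum)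
      fix X assume "X \<in> space ?P"
      then have "best_mean f l m X \<in> ?S" using m by (intro best_mean_in_cball) auto
      from K(2)[OF this] show "f (best_mean f l m X) \<le> K * (\<Sum>c\<in>UNIV. ((best_mean f l m X - xs) $ c)\<^sup>2)"
        by (simp add: norm_vec_def L2_set_def sum_nonneg)
    qed
    also have "\<dots> = K * (\<Sum>c\<in>UNIV. P.expectation (\<lambda>X. ((best_mean f l m X - xs) $ c)\<^sup>2))"
      using int_c by (simp add: Bochner_Integration.integral_sum)
    also have "\<dots> \<le> K * (\<Sum>c\<in>(UNIV :: 'n set). Cc\<^sup>2 * (\<Gamma> (\<alpha> - 1) * (real m / real l) powr (2 * (\<alpha> - 1) / ?d))
        + C0 / real m * (\<Gamma> 1 * (real m / real l) powr (2 * 1 / ?d)))"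
    proof (intro mult_left_mono sum_mono)
      fix c :: 'n
      note second[of c]
      also have "Cc\<^sup>2 * P.expectation (\<lambda>X. h X powr (\<alpha> - 1)) + C0 / real m * P.expectation (\<lambda>X. h X powr 1)
        \<le> Cc\<^sup>2 * (\<Gamma> (\<alpha> - 1) * (real m / real l) powr (2 * (\<alpha> - 1) / ?d))
        + C0 / real m * (\<Gamma> 1 * (real m / real l) powr (2 * 1 / ?d))"
        using \<alpha> C0 by (intro add_mono mult_left_mono moment) auto
      finally show "P.expectation (\<lambda>X. ((best_mean f l m X - xs) $ c)\<^sup>2) \<le> \<dots>" .
    qed (use K in auto)
    also have "\<dots> = K * ?d * Cc\<^sup>2 * \<Gamma> (\<alpha> - 1) * (real m / real l) powr (2 * (\<alpha> - 1) / ?d)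
        + K * ?d * C0 * \<Gamma> 1 * ((real m / real l) powr (2 / ?d) / real m)"
      by (simp add: algebra_simps)
    also have "(real m / real l) powr (2 / ?d) / real m = real m powr (2 / ?d - 1) / real l powr (2 / ?d)"
      using m by (simp add: powr_divide powr_diff)
    also have "(real m / real l) powr (2 * (\<alpha> - 1) / ?d) = real m powr (2 * (\<alpha> - 1) / ?d) / real l powr (2 * (\<alpha> - 1) / ?d)"
      using m by (simp add: powr_divide)
    finally show ?thesis .
  qed
  show thesis
  \<comment> \<open>Absolute values and the added 1 make both constants visibly positive.\<close>
  proof (rule that[of "\<bar>K * ?d * Cc\<^sup>2 * \<Gamma> (\<alpha> - 1)\<bar> + 1" "\<bar>K * ?d * C0 * \<Gamma> 1\<bar> + 1"])
    fix l m :: nat assume m: "1 \<le> m" "m < l"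
    show "expected_value r f l m
      \<le> (\<bar>K * ?d * Cc\<^sup>2 * \<Gamma> (\<alpha> - 1)\<bar> + 1) * (real m powr (2 * (\<alpha> - 1) / ?d) / real l powr (2 * (\<alpha> - 1) / ?d))
        + (\<bar>K * ?d * C0 * \<Gamma> 1\<bar> + 1) * (real m powr (2 / ?d - 1) / real l powr (2 / ?d))"
      by (rule order_trans[OF key[OF m] add_mono]; rule mult_right_mono) auto
  qed auto
qed

text \<open>Adding both powers covers either sign of \<open>p\<close>: the upper bound on
  \<open>x\<close> is used for p \<ge> 0 and the lower one otherwise. The exponent 2/d - 1 is
  negative for d > 2.\<close>

lemma powr_le_of_between:
  fixes x y a b p :: real
  assumes "0 < a" "0 < y" "a * y \<le> x" "x \<le> b * y"
  shows "x powr p \<le> (a powr p + b powr p) * y powr p"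
proof -
  have x: "0 < x" using assms by (meson less_le_trans mult_pos_pos)
  have b: "0 < b" using x assms by (metis less_le_trans zero_less_mult_pos2)
  have "x powr p \<le> a powr p * y powr p \<or> x powr p \<le> b powr p * y powr p"
  proof (cases "0 \<le> p")
    case True
    then have "x powr p \<le> (b * y) powr p" using assms x by (intro powr_mono2) auto
    then show ?thesis using assms b by (simp add: powr_mult)
  next
    case False
    then have "x powr p \<le> (a * y) powr p" using assms by (intro powr_mono2') auto
    then show ?thesis using assms by (simp add: powr_mult)
  qed
  then show ?thesis by (auto simp: distrib_right intro: order_trans)
qed

theorem theorem1:
  fixes f :: "real ^ 'n \<Rightarrow> real" and r \<alpha> :: real and d :: nat and \<mu> :: "nat \<Rightarrow> nat"
  assumes "d = CARD('n)"
    and "r > 0"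
    and "assumption_A r \<alpha> f"
    and "\<And>l. l \<ge> 2 \<Longrightarrow> 1 \<le> \<mu> l \<and> \<mu> l \<le> l - 1"
    and "filterlim \<mu> at_top at_top"
  shows "\<exists>C C' l0. C > 0 \<and> C' > 0 \<and>
    (\<forall>l\<ge>l0. expected_value r f l (\<mu> l)
        \<le> C * (real (\<mu> l) powr (2 * (\<alpha> - 1) / real d) / real l powr (2 * (\<alpha> - 1) / real d))
          + C' * (real (\<mu> l) powr (2 / real d - 1) / real l powr (2 / real d))) \<and>
    (\<forall>C''>0. (\<lambda>l. real (\<mu> l)) \<sim>[at_top]
               (\<lambda>l. C'' * real l powr (2 * (\<alpha> - 2) / (real d + 2 * (\<alpha> - 2)))) \<longrightarrow>
       (\<exists>C'''>0. \<forall>l\<ge>l0. expected_value r f l (\<mu> l)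
          \<le> C''' * real l powr (- (2 * (\<alpha> - 1) / (real d + 2 * (\<alpha> - 2))))))"
proof -
  have \<alpha>: "2 < \<alpha>" using assms(3) by (simp add: assumption_A_def)
  have d: "0 < real d" using assms(1) by simp
  obtain C C' where C: "0 < C" "0 < C'" "\<And>l m. 1 \<le> m \<Longrightarrow> m < l \<Longrightarrow> expected_value r f l m
     \<le> C * (real m powr (2 * (\<alpha> - 1) / real d) / real l powr (2 * (\<alpha> - 1) / real d))
      + C' * (real m powr (2 / real d - 1) / real l powr (2 / real d))"
    using expected_value_le[OF assms(2,3)] unfolding assms(1) by metis
  have bound: "expected_value r f l (\<mu> l)
        \<le> C * (real (\<mu> l) powr (2 * (\<alpha> - 1) / real d) / real l powr (2 * (\<alpha> - 1) / real d))
          + C' * (real (\<mu> l) powr (2 / real d - 1) / real l powr (2 / real d))" if "2 \<le> l" for l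
    using assms(4)[OF that] that by (intro C(3)) auto
  \<comment> \<open>\<open>\<gamma>\<close> is the prescribed growth exponent of
    \<open>\<mu>\<close> and \<open>\<eta>\<close> the rate to be shown. The choice of
    \<open>\<gamma>\<close> balances the two terms of \<open>bound\<close>: both decay like
    l^(-\<eta>), as \<open>ex1\<close> and \<open>ex2\<close> verify.\<close>
  define G where "G = real d + 2 * (\<alpha> - 2)"
  define \<gamma> where "\<gamma> = 2 * (\<alpha> - 2) / G"
  define \<eta> where "\<eta> = 2 * (\<alpha> - 1) / G"
  have G: "0 < G" using d \<alpha> by (simp add: G_def)
  have "\<exists>C'''>0. \<forall>l\<ge>2. expected_value r f l (\<mu> l) \<le> C''' * real l powr (- \<eta>)"
    if "0 < C''" and equiv: "(\<lambda>l. real (\<mu> l)) \<sim>[at_top] (\<lambda>l. C'' * real l powr \<gamma>)" for C''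
  proof -
    let ?e1 = "2 * (\<alpha> - 1) / real d" and ?e2 = "2 / real d - 1"
    define c1 where "c1 = (C'' / 2) powr ?e1 + (2 * C'') powr ?e1"
    define c2 where "c2 = (C'' / 2) powr ?e2 + (2 * C'') powr ?e2"
    have ex1: "\<gamma> * ?e1 - ?e1 = - \<eta>"
    proof -
      have "\<gamma> - 1 = - real d / G" using G by (simp add: \<gamma>_def G_def field_simps)
      then have "?e1 * (\<gamma> - 1) = - \<eta>" using d by (simp add: \<eta>_def)
      then show ?thesis by (simp only: right_diff_distrib mult.commute[of \<gamma>] mult_1_right)
    qed
    have ex2: "\<gamma> * ?e2 - 2 / real d = - \<eta>"
    proof -
      have "\<gamma> - 1 = - real d / G" using G by (simp add: \<gamma>_def G_def field_simps)
      then have "2 / real d * (\<gamma> - 1) = - 2 / G" using d by simp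
      moreover have "\<gamma> * ?e2 - 2 / real d = 2 / real d * (\<gamma> - 1) - \<gamma>"
        by (simp only: right_diff_distrib mult.commute[of \<gamma>] mult_1_right)
      ultimately have "\<gamma> * ?e2 - 2 / real d = - 2 / G - \<gamma>" by simp
      also have "\<dots> = - \<eta>" by (simp add: \<gamma>_def \<eta>_def diff_divide_distrib algebra_simps)
      finally show ?thesis .
    qed
    \<comment> \<open>Asymptotic equivalence is convergence of the quotient, set to 1 where both
      sides vanish. For \<open>l \<ge> 2\<close> the comparison function is positive, so the true
      quotient eventually lies between 1/2 and 2.\<close>
    have "((\<lambda>l. if real (\<mu> l) = 0 \<and> C'' * real l powr \<gamma> = 0 then 1
        else real (\<mu> l) / (C'' * real l powr \<gamma>)) \<longlongrightarrow> 1) at_top"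
      using equiv by (simp add: asymp_equiv_def)
    then have "eventually (\<lambda>l. (if real (\<mu> l) = 0 \<and> C'' * real l powr \<gamma> = 0 then 1
        else real (\<mu> l) / (C'' * real l powr \<gamma>)) \<in> {1/2<..<2}) at_top"
      by (rule topological_tendstoD) auto
    then obtain L where L: "\<And>l. L \<le> l \<Longrightarrow> (if real (\<mu> l) = 0 \<and> C'' * real l powr \<gamma> = 0 then 1
        else real (\<mu> l) / (C'' * real l powr \<gamma>)) \<in> {1/2<..<2}"
      unfolding eventually_at_top_linorder by blast
    define C0 where "C0 = C * c1 + C' * c2"
    have tail: "expected_value r f l (\<mu> l) \<le> C0 * real l powr (- \<eta>)" if l: "2 \<le> l" "L \<le> l" for l
    proof -
      have lpos: "0 < real l powr \<gamma>" using l by simp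
      have "real (\<mu> l) / (C'' * real l powr \<gamma>) \<in> {1/2<..<2}"
        using L[OF l(2)] lpos \<open>0 < C''\<close> by simp
      then have btw: "C'' / 2 * real l powr \<gamma> \<le> real (\<mu> l)" "real (\<mu> l) \<le> 2 * C'' * real l powr \<gamma>"
        using lpos \<open>0 < C''\<close> by (auto simp: field_simps)
      have pw: "real (\<mu> l) powr p \<le> ((C'' / 2) powr p + (2 * C'') powr p) * real l powr (\<gamma> * p)" for p
        using powr_le_of_between[OF _ lpos btw, of p] \<open>0 < C''\<close> by (simp add: powr_powr)
      have "expected_value r f l (\<mu> l)
        \<le> C * (real (\<mu> l) powr ?e1 / real l powr ?e1) + C' * (real (\<mu> l) powr ?e2 / real l powr (2 / real d))"
        by (rule bound[OF l(1)])
      also have "\<dots> \<le> C * (c1 * real l powr (\<gamma> * ?e1) / real l powr ?e1)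
          + C' * (c2 * real l powr (\<gamma> * ?e2) / real l powr (2 / real d))"
        unfolding c1_def c2_def using C(1,2) by (intro add_mono mult_left_mono divide_right_mono pw) auto
      also have "\<dots> = C * (c1 * real l powr (\<gamma> * ?e1 - ?e1)) + C' * (c2 * real l powr (\<gamma> * ?e2 - 2 / real d))"
        by (simp add: powr_diff)
      also have "\<dots> = C0 * real l powr (- \<eta>)"
        unfolding ex1 ex2 C0_def by (simp add: algebra_simps)
      finally show ?thesis .
    qed
    \<comment> \<open>Both bounds must hold from the same index 2 on, while \<open>L\<close> depends
      on \<open>C''\<close>; so the finitely many \<open>l\<close> below \<open>L\<close> are
      absorbed into the constant. The summand for \<open>l = 0\<close> is 0, since division by 0
      yields 0.\<close>
    define C3 where "C3 = \<bar>C0\<bar> + 1 + (\<Sum>l<L. \<bar>expected_value r f l (\<mu> l)\<bar> / real l powr (- \<eta>))"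
    have S: "0 \<le> (\<Sum>l<L. \<bar>expected_value r f l (\<mu> l)\<bar> / real l powr (- \<eta>))"
      by (intro sum_nonneg) auto
    have "expected_value r f l (\<mu> l) \<le> C3 * real l powr (- \<eta>)" if l: "2 \<le> l" for l
    proof (cases "L \<le> l")
      case True
      have "C0 * real l powr (- \<eta>) \<le> C3 * real l powr (- \<eta>)"
        using S by (intro mult_right_mono) (auto simp: C3_def)
      then show ?thesis using tail[OF l True] by linarith
    next
      case False
      have pos: "0 < real l powr (- \<eta>)" using l by simp
      have "\<bar>expected_value r f l (\<mu> l)\<bar> / real l powr (- \<eta>)
          \<le> (\<Sum>l<L. \<bar>expected_value r f l (\<mu> l)\<bar> / real l powr (- \<eta>))"
        using False by (intro member_le_sum[of l "{..<L}" "\<lambda>l. \<bar>expected_value r f l (\<mu> l)\<bar> / real l powr (- \<eta>)"]) auto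
      also have "\<dots> \<le> C3" by (simp add: C3_def)
      finally have "\<bar>expected_value r f l (\<mu> l)\<bar> \<le> C3 * real l powr (- \<eta>)"
        using pos by (simp add: pos_divide_le_eq)
      then show ?thesis by linarith
    qed
    moreover have "0 < C3" using S by (simp add: C3_def add_pos_nonneg)
    ultimately show ?thesis by blast
  qed
  note special = this[unfolded \<gamma>_def \<eta>_def G_def]
  show ?thesis
    by (rule exI[of _ C], rule exI[of _ C'], rule exI[of _ 2])
       (intro conjI C(1,2), (intro allI impI, rule bound, assumption), (intro allI impI, rule special))
qed

end
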